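(* Assume Geelen's weak vertex-minor structure conjecture for stabilizer states (stated in the context). Let $\mathcal{F}$ be a proper vertex-minor-closed family of stabilizer states and let $k\in\mathbb{N}$ be the parameter attached to $\mathcal{F}$ by the conjecture (that is, for some $p\in\mathbb{N}$, every $k$-rank-connected state in $\mathcal{F}$ is locally equivalent to a rank-$p$ perturbation of a circle graph state). Let $|\psi_n\rangle\in\mathcal{F}$ be an $n$-qubit stabilizer state. Then either $|\psi_n\rangle$ is not $k$-rank-connected, or both of the following hold: (i) $\alpha_{\rm loc}(|\psi_n\rangle)=\Omega\left(\frac{n}{\log n}\right)$; (ii) $d(|\psi_n\rangle)=O(\log n)$. Here the asymptotic notation is as $n\to\infty$, uniformly over the state: there are constants $c,C>0$ and $N\in\mathbb{N}$, depending only on $\mathcal{F}$ and $k$, such that every $k$-rank-connected $n$-qubit state $|\psi_n\rangle\in\mathcal{F}$ with $n\ge N$ satisfies $\alpha_{\rm loc}(|\psi_n\rangle)\ge c\,n/\log n$ and $d(|\psi_n\rangle)\le C\log n$.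
   Context: Stabilizer states. Qubits are indexed by a finite set $V$ with $|V|=n$. A Pauli string is $P=\bigotimes_{v\in V}P_v$ with $P_v\in\{I,X,Y,Z\}$; its support is $\operatorname{supp}(P)=\{v:P_v\ne I\}$ and its weight is $w(P)=|\operatorname{supp}(P)|$. The Pauli group is $\mathcal{P}_n=\{\omega P:\omega\in\{\pm1,\pm i\},\ P \text{ a Pauli string}\}$ (support and weight ignore the phase). A stabilizer group $\mathcal{S}\subset\mathcal{P}_n$ is an abelian subgroup with $-I\notin\mathcal{S}$ generated by $n$ independent elements; the stabilizer state $|\psi\rangle$ with stabilizer group $\mathcal{S}$ is the unit vector, unique up to global phase, with $S|\psi\rangle=|\psi\rangle$ for all $S\in\mathcal{S}$. For a simple graph $G$ on $V$, the graph state $|G\rangle$ is the stabilizer state whose group is generated by $X_v\prod_{u\in N_v}Z_u$, $v\in V$, where $N_v$ is the open neighbourhood of $v$. Entanglement measures. For $U\subseteq\operatorname{supp}(P)$, $P_U$ is the Pauli string agreeing with $P$ on $U$ and equal to $I$ elsewhere. $\mathcal{I}(\mathcal{S},P)$ is the group of elements of $\mathcal{S}$ that are equal, up to phase, to some $P_U$ with $U\subseteq\operatorname{supp}(P)$; the nullity is $\nu(P)=\dim\mathcal{I}(\mathcal{S},P)=\log_2|\mathcal{I}(\mathcal{S},P)|$. The locally accessible information is $\alpha_{\rm loc}(|\psi\rangle)=\max_P\nu(P)$ over all Pauli strings $P$ (equivalently over those with $w(P)=n$). The distance $d(|\psi\rangle)$ is the minimum weight of a non-identity element of $\mathcal{S}$.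 Local equivalence and vertex-minors. Two stabilizer states are locally equivalent if one is obtained from the other (up to global phase) by a tensor product of single-qubit Clifford unitaries (unitaries normalizing the single-qubit Pauli group). A stabilizer state $|\phi\rangle$ is a vertex-minor of $|\psi\rangle$ if it can be obtained from $|\psi\rangle$ by a sequence of single-qubit Clifford unitaries and destructive single-qubit Pauli measurements (the measured qubit is discarded). A family of stabilizer states is proper vertex-minor-closed if it is closed under taking vertex-minors and is not the family of all stabilizer states. Rank-connectivity. For a stabilizer state with group $\mathcal{S}$ and $W\subseteq V$, $\operatorname{cutrk}(W)=|W|-\dim\{S\in\mathcal{S}:\operatorname{supp}(S)\subseteq W\}$, where $\dim$ of such a subgroup is $\log_2$ of its size. The state is $k$-rank-connected if $|V|\ge 2k$ and $\operatorname{cutrk}(W)\ge\min(|W|,|V\setminus W|,k)$ for all $W\subseteq V$. Perturbations and circle graphs. A rank-$p$ perturbation of a graph $G$ (or of $|G\rangle$) is a graph (or its graph state) whose adjacency matrix is obtained by adding over $\mathbb{F}_2$ a symmetric matrix of rank at most $p$ to the adjacency matrix of $G$ and then setting all diagonal entries to $0$. A circle graph is the intersection graph of a finite collection of chords of a circle; a circle graph state is $|G\rangle$ with $G$ a circle graph. Geelen's weak vertex-minor structure conjecture for stabilizer states: for every proper vertex-minor-closed family $\mathcal{F}$ of stabilizer states there exist $k,p\in\mathbb{N}$ such that each state in $\mathcal{F}$ that is $k$-rank-connected is locally equivalent to a rank-$p$ perturbation of a circle graph state. *)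

theory Defs
  imports
    "HOL-Analysis.Analysis"
    "HOL-Algebra.Generated_Groups"
    "HOL-Library.Function_Algebras"
    "HOL-Library.Z2"
begin

section \<open>The Pauli group\<close>

datatype pauli = PauliI | PauliX | PauliY | PauliZ

text \<open>One-qubit operators are \<open>2 \<times> 2\<close> matrices indexed by \<^typ>\<open>bool\<close>; \<^term>\<open>False\<close> stands
  for the basis vector \<open>|0\<rangle>\<close> and \<^term>\<open>True\<close> for \<open>|1\<rangle>\<close>.\<close>

primrec pauli_mat :: "pauli \<Rightarrow> complex^bool^bool" where
  "pauli_mat PauliI = mat 1"
| "pauli_mat PauliX = (\<chi> i j. if i \<noteq> j then 1 else 0)"
| "pauli_mat PauliY = (\<chi> i j. if i = j then 0 else if i then \<i> else - \<i>)"
| "pauli_mat PauliZ = (\<chi> i j. if i \<noteq> j then 0 else if i then - 1 else 1)"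

fun pauli_prod :: "pauli \<Rightarrow> pauli \<Rightarrow> complex \<times> pauli" where
  "pauli_prod PauliI b = (1, b)"
| "pauli_prod a PauliI = (1, a)"
| "pauli_prod PauliX PauliX = (1, PauliI)"
| "pauli_prod PauliY PauliY = (1, PauliI)"
| "pauli_prod PauliZ PauliZ = (1, PauliI)"
| "pauli_prod PauliX PauliY = (\<i>, PauliZ)"
| "pauli_prod PauliY PauliX = (- \<i>, PauliZ)"
| "pauli_prod PauliY PauliZ = (\<i>, PauliX)"
| "pauli_prod PauliZ PauliY = (- \<i>, PauliX)"
| "pauli_prod PauliZ PauliX = (\<i>, PauliY)"
| "pauli_prod PauliX PauliZ = (- \<i>, PauliY)"

lemma pauli_prod_correct:
  "(pauli_mat a ** pauli_mat b) $ i $ j =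
     fst (pauli_prod a b) * pauli_mat (snd (pauli_prod a b)) $ i $ j"
  by (cases a; cases b; cases i; cases j)
     (simp_all add: matrix_matrix_mult_def UNIV_bool mat_def)

definition supp :: "('v \<Rightarrow> pauli) \<Rightarrow> 'v set" where
  "supp P = {v. P v \<noteq> PauliI}"

definition weight :: "('v \<Rightarrow> pauli) \<Rightarrow> nat" where
  "weight P = card (supp P)"

definition pauli_strings :: "'v set \<Rightarrow> ('v \<Rightarrow> pauli) set" where
  "pauli_strings V = {P. supp P \<subseteq> V}"

definition pauli_restrict :: "('v \<Rightarrow> pauli) \<Rightarrow> 'v set \<Rightarrow> 'v \<Rightarrow> pauli" where
  "pauli_restrict P U = (\<lambda>v. if v \<in> U then P v else PauliI)"

definition pauli_phases :: "complex set" where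
  "pauli_phases = {1, - 1, \<i>, - \<i>}"

text \<open>The element \<open>\<omega>P\<close> of the Pauli group is represented by the pair \<open>(\<omega>, P)\<close>; this is
  unique, because distinct Pauli strings are not proportional to each other.\<close>

type_synonym 'v pauli_elt = "complex \<times> ('v \<Rightarrow> pauli)"

definition pauli_group :: "'v set \<Rightarrow> 'v pauli_elt monoid" where
  "pauli_group V =
    \<lparr> carrier = pauli_phases \<times> pauli_strings V,
      monoid.mult = (\<lambda>(\<omega>, P) (\<eta>, Q).
        (\<omega> * \<eta> * (\<Prod>v\<in>V. fst (pauli_prod (P v) (Q v))), \<lambda>v. snd (pauli_prod (P v) (Q v)))),
      one = (1, \<lambda>_. PauliI) \<rparr>"

section \<open>States and operators\<close>

text \<open>A vector of \<open>\<Otimes>\<^sub>v\<^sub>\<in>\<^sub>V \<complex>\<^sup>2\<close> is given by its coefficients in the computational basis. The basis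
  vector in which exactly the qubits of \<open>A \<subseteq> V\<close> are \<open>|1\<rangle>\<close> is indexed by \<open>A\<close>, and
  coefficients at sets that are not subsets of \<open>V\<close> are \<open>0\<close>. A state carries its set of
  qubits, since measurements discard qubits.\<close>

type_synonym 'v qvec = "'v set \<Rightarrow> complex"
type_synonym 'v qstate = "'v set \<times> 'v qvec"

definition unit_qvec :: "'v set \<Rightarrow> 'v qvec \<Rightarrow> bool" where
  "unit_qvec V \<psi> \<longleftrightarrow> (\<forall>A. \<not> A \<subseteq> V \<longrightarrow> \<psi> A = 0) \<and> (\<Sum>A\<in>Pow V. (cmod (\<psi> A))\<^sup>2) = 1"

definition tensor_op :: "'v set \<Rightarrow> ('v \<Rightarrow> complex^bool^bool) \<Rightarrow> 'v qvec \<Rightarrow> 'v qvec" where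
  "tensor_op V M \<psi> = (\<lambda>A.
     if A \<subseteq> V then \<Sum>B\<in>Pow V. (\<Prod>v\<in>V. M v $ (v \<in> A) $ (v \<in> B)) * \<psi> B else 0)"

definition pauli_op :: "'v set \<Rightarrow> 'v pauli_elt \<Rightarrow> 'v qvec \<Rightarrow> 'v qvec" where
  "pauli_op V s \<psi> = (\<lambda>A. fst s * tensor_op V (\<lambda>v. pauli_mat (snd s v)) \<psi> A)"

section \<open>Stabilizer states\<close>

definition independent_generators :: "'v set \<Rightarrow> 'v pauli_elt set \<Rightarrow> bool" where
  "independent_generators V B \<longleftrightarrow>
     B \<subseteq> carrier (pauli_group V) \<and> (\<forall>b\<in>B. b \<notin> generate (pauli_group V) (B - {b}))"

definition stabilizer_group :: "'v set \<Rightarrow> 'v pauli_elt set \<Rightarrow> bool" where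
  "stabilizer_group V S \<longleftrightarrow>
     subgroup S (pauli_group V) \<and>
     (\<forall>s\<in>S. \<forall>t\<in>S. s \<otimes>\<^bsub>pauli_group V\<^esub> t = t \<otimes>\<^bsub>pauli_group V\<^esub> s) \<and>
     (- 1, \<lambda>_. PauliI) \<notin> S \<and>
     (\<exists>B. finite B \<and> card B = card V \<and> independent_generators V B \<and>
          generate (pauli_group V) B = S)"

definition stabilizer_states :: "'v qstate set" where
  "stabilizer_states = {(V, \<psi>). finite V \<and> unit_qvec V \<psi> \<and>
     (\<exists>S. stabilizer_group V S \<and> (\<forall>s\<in>S. pauli_op V s \<psi> = \<psi>))}"

text \<open>A stabilizer group is a maximal commuting set of Pauli operators without \<open>-I\<close>. Hence a
  stabilizer group that fixes the unit vector \<open>\<psi>\<close> is the set of all elements of the Pauli group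
  that fix \<open>\<psi>\<close>.\<close>

definition stab :: "'v set \<Rightarrow> 'v qvec \<Rightarrow> 'v pauli_elt set" where
  "stab V \<psi> = {s \<in> carrier (pauli_group V). pauli_op V s \<psi> = \<psi>}"

section \<open>Nullity, locally accessible information, distance, rank-connectivity\<close>

definition local_subgroup :: "'v pauli_elt set \<Rightarrow> ('v \<Rightarrow> pauli) \<Rightarrow> 'v pauli_elt set" where
  "local_subgroup S P = {s \<in> S. \<exists>U\<subseteq>supp P. snd s = pauli_restrict P U}"

definition nullity :: "'v pauli_elt set \<Rightarrow> ('v \<Rightarrow> pauli) \<Rightarrow> real" where
  "nullity S P = log 2 (real (card (local_subgroup S P)))"

definition alpha_loc :: "'v set \<Rightarrow> 'v qvec \<Rightarrow> real" where
  "alpha_loc V \<psi> = (MAX P\<in>pauli_strings V. nullity (stab V \<psi>) P)"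

definition distance :: "'v set \<Rightarrow> 'v qvec \<Rightarrow> nat" where
  "distance V \<psi> = (MIN s\<in>stab V \<psi> - {\<one>\<^bsub>pauli_group V\<^esub>}. weight (snd s))"

definition cut_rank :: "'v set \<Rightarrow> 'v qvec \<Rightarrow> 'v set \<Rightarrow> real" where
  "cut_rank V \<psi> W = real (card W) - log 2 (real (card {s \<in> stab V \<psi>. supp (snd s) \<subseteq> W}))"

definition rank_connected :: "nat \<Rightarrow> 'v set \<Rightarrow> 'v qvec \<Rightarrow> bool" where
  "rank_connected k V \<psi> \<longleftrightarrow>
     2 * k \<le> card V \<and>
     (\<forall>W\<subseteq>V. real (min (card W) (min (card (V - W)) k)) \<le> cut_rank V \<psi> W)"

section \<open>Local equivalence and vertex-minors\<close>

definition adjoint_mat :: "complex^bool^bool \<Rightarrow> complex^bool^bool" where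
  "adjoint_mat U = (\<chi> i j. cnj (U $ j $ i))"

definition pauli_mats :: "(complex^bool^bool) set" where
  "pauli_mats = {\<chi> i j. \<omega> * pauli_mat a $ i $ j | \<omega> a. \<omega> \<in> pauli_phases}"

definition clifford :: "complex^bool^bool \<Rightarrow> bool" where
  "clifford U \<longleftrightarrow>
     U ** adjoint_mat U = mat 1 \<and> adjoint_mat U ** U = mat 1 \<and>
     (\<lambda>Q. U ** Q ** adjoint_mat U) ` pauli_mats = pauli_mats"

definition locally_equivalent :: "'v set \<Rightarrow> 'v qvec \<Rightarrow> 'v qvec \<Rightarrow> bool" where
  "locally_equivalent V \<psi> \<phi> \<longleftrightarrow>
     (\<exists>U c. (\<forall>v\<in>V. clifford (U v)) \<and> cmod c = 1 \<and> \<phi> = (\<lambda>A. c * tensor_op V U \<psi> A))"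

text \<open>\<open>(\<langle>x|\<^sub>v \<otimes> I) \<psi>\<close>, a vector on the qubits \<open>V - {v}\<close>.\<close>

definition partial_bra :: "'v set \<Rightarrow> 'v \<Rightarrow> complex^bool \<Rightarrow> 'v qvec \<Rightarrow> 'v qvec" where
  "partial_bra V v x \<psi> = (\<lambda>A. if A \<subseteq> V - {v}
     then cnj (x $ False) * \<psi> A + cnj (x $ True) * \<psi> (insert v A) else 0)"

text \<open>In the rule \<open>measure\<close>, the Pauli operator \<open>a\<close> is measured on qubit \<open>v\<close> with outcome
  \<open>e = \<plusminus>1\<close>. The outcome has nonzero probability iff \<open>partial_bra V v x \<psi> \<noteq> 0\<close>, where \<open>x\<close> is the
  \<open>e\<close>-eigenvector of \<open>a\<close>, and then the state after the measurement is \<open>x \<otimes> \<phi>\<close> where \<open>\<phi>\<close> is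
  that vector normalized, up to global phase.\<close>

inductive minor_step :: "'v qstate \<Rightarrow> 'v qstate \<Rightarrow> bool" where
  unitary: "minor_step (V, \<psi>) (V, tensor_op V (\<lambda>u. if u = v then U else mat 1) \<psi>)"
    if "v \<in> V" "clifford U"
| measure: "minor_step (V, \<psi>) (V - {v}, \<phi>)"
    if "v \<in> V" "a \<in> {PauliX, PauliY, PauliZ}" "e \<in> {1, - 1}"
      "x \<noteq> 0" "pauli_mat a *v x = e *s x"
      "unit_qvec (V - {v}) \<phi>" "c \<noteq> 0" "partial_bra V v x \<psi> = (\<lambda>A. c * \<phi> A)"

definition vertex_minor :: "'v qstate \<Rightarrow> 'v qstate \<Rightarrow> bool" where
  "vertex_minor \<Phi> \<Psi> \<longleftrightarrow> \<Phi> \<in> stabilizer_states \<and> minor_step\<^sup>*\<^sup>* \<Psi> \<Phi>"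

text \<open>Renaming of qubits, up to global phase. The names of the qubits are immaterial, so a family of
  states has to be invariant under renaming. Without this requirement, the states whose qubits have
  even labels would be a proper vertex-minor-closed family containing a copy of every state.\<close>

definition state_iso :: "'v qstate \<Rightarrow> 'v qstate \<Rightarrow> bool" where
  "state_iso \<Psi> \<Phi> \<longleftrightarrow>
     (\<exists>f c. bij_betw f (fst \<Psi>) (fst \<Phi>) \<and> cmod c = 1 \<and>
            (\<forall>A\<subseteq>fst \<Psi>. snd \<Phi> (f ` A) = c * snd \<Psi> A))"

definition state_family :: "'v qstate set \<Rightarrow> bool" where
  "state_family F \<longleftrightarrow> F \<subseteq> stabilizer_states \<and>
     (\<forall>\<Psi>\<in>F. \<forall>\<Phi>\<in>stabilizer_states. state_iso \<Psi> \<Phi> \<longrightarrow> \<Phi> \<in> F)"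

definition proper_vertex_minor_closed :: "'v qstate set \<Rightarrow> bool" where
  "proper_vertex_minor_closed F \<longleftrightarrow>
     state_family F \<and> (\<forall>\<Psi>\<in>F. \<forall>\<Phi>. vertex_minor \<Phi> \<Psi> \<longrightarrow> \<Phi> \<in> F) \<and> F \<noteq> stabilizer_states"

section \<open>Graphs, graph states and perturbations\<close>

definition simple_graph :: "'v set \<Rightarrow> 'v rel \<Rightarrow> bool" where
  "simple_graph V E \<longleftrightarrow> finite V \<and> E \<subseteq> V \<times> V \<and> sym E \<and> irrefl E"

definition graph_generator :: "'v rel \<Rightarrow> 'v \<Rightarrow> 'v pauli_elt" where
  "graph_generator E v =
     (1, \<lambda>u. if u = v then PauliX else if u \<in> E `` {v} then PauliZ else PauliI)"

definition graph_state :: "'v set \<Rightarrow> 'v rel \<Rightarrow> 'v qvec \<Rightarrow> bool" where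
  "graph_state V E \<psi> \<longleftrightarrow> simple_graph V E \<and> (V, \<psi>) \<in> stabilizer_states \<and>
     stab V \<psi> = generate (pauli_group V) (graph_generator E ` V)"

definition circle_graph :: "'v set \<Rightarrow> 'v rel \<Rightarrow> bool" where
  "circle_graph V E \<longleftrightarrow> simple_graph V E \<and>
     (\<exists>a b :: 'v \<Rightarrow> complex.
        (\<forall>v\<in>V. a v \<in> sphere 0 1 \<and> b v \<in> sphere 0 1 \<and> a v \<noteq> b v) \<and>
        (\<forall>u\<in>V. \<forall>v\<in>V. u \<noteq> v \<longrightarrow>
           ((u, v) \<in> E \<longleftrightarrow> closed_segment (a u) (b u) \<inter> closed_segment (a v) (b v) \<noteq> {})))"

interpretation bit_fun: vector_space "\<lambda>(c::bit) (f::'v \<Rightarrow> bit) v. c * f v"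
  by unfold_locales (auto simp: fun_eq_iff algebra_simps)

text \<open>The rank of a \<open>V \<times> V\<close> matrix is the dimension of its row space.\<close>

definition bit_rank :: "'v set \<Rightarrow> ('v \<Rightarrow> 'v \<Rightarrow> bit) \<Rightarrow> nat" where
  "bit_rank V M = bit_fun.dim ((\<lambda>u v. if v \<in> V then M u v else 0) ` V)"

definition adjacency :: "'v rel \<Rightarrow> 'v \<Rightarrow> 'v \<Rightarrow> bit" where
  "adjacency E u v = of_bool ((u, v) \<in> E)"

text \<open>\<open>E'\<close> is a rank-\<open>p\<close> perturbation of \<open>E\<close>. Resetting the diagonal to \<open>0\<close> amounts to comparing
  only off-diagonal entries, since \<open>E'\<close> is a simple graph.\<close>

definition rank_perturbation :: "nat \<Rightarrow> 'v set \<Rightarrow> 'v rel \<Rightarrow> 'v rel \<Rightarrow> bool" where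
  "rank_perturbation p V E E' \<longleftrightarrow> simple_graph V E \<and> simple_graph V E' \<and>
     (\<exists>M. (\<forall>u\<in>V. \<forall>v\<in>V. M u v = M v u) \<and> bit_rank V M \<le> p \<and>
          (\<forall>u\<in>V. \<forall>v\<in>V. u \<noteq> v \<longrightarrow> adjacency E' u v = adjacency E u v + M u v))"

section \<open>The weak vertex-minor structure conjecture\<close>

definition structure_parameters :: "'v qstate set \<Rightarrow> nat \<Rightarrow> nat \<Rightarrow> bool" where
  "structure_parameters F k p \<longleftrightarrow>
     (\<forall>(V, \<psi>)\<in>F. rank_connected k V \<psi> \<longrightarrow>
        (\<exists>H E \<phi>. circle_graph V H \<and> rank_perturbation p V H E \<and> graph_state V E \<phi> \<and>
                 locally_equivalent V \<psi> \<phi>))"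

definition weak_structure_conjecture :: bool where
  "weak_structure_conjecture \<longleftrightarrow>
     (\<forall>F :: nat qstate set. proper_vertex_minor_closed F \<longrightarrow> (\<exists>k p. structure_parameters F k p))"

end

theory Submission
  imports Defs "HOL-Library.List_Lexorder"
begin

text \<open>
  The generator product over \<open>D \<subseteq> V\<close> of a graph state acts nontrivially exactly on \<open>D\<close> and on the
  vertices with an odd number of neighbours in \<open>D\<close>. If there are many sets \<open>D\<close> for which these
  supports are small and pairwise disjoint, then their products are restrictions of one Pauli string,
  so their number bounds \<open>\<alpha>\<^sub>l\<^sub>o\<^sub>c\<close> from below and their size bounds the distance from above.

  A circle graph is a double occurrence word of length \<open>2n\<close>. Cut the word into blocks of bounded length
  and let every letter be an edge joining the blocks of its two occurrences. If every block has even
  degree in a set \<open>D\<close> of letters, then a letter without occurrence in the blocks met by \<open>D\<close> is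
  interlaced with an even number of letters of \<open>D\<close>, because the part of the word between its
  occurrences consists of whole blocks as far as \<open>D\<close> is concerned. So a short cycle of the dense
  multigraph on the blocks is a set \<open>D\<close> of small support, and as cycles of logarithmic length persist
  after the deletion of few letters, there are \<open>\<Omega>(n / log n)\<close> of them with disjoint supports.

  A rank-\<open>p\<close> perturbation adds a matrix \<open>M\<close>. Among \<open>2^p + 1\<close> of the sets \<open>D\<close>, two have the same sum
  of rows of \<open>M\<close>, hence their union lies in the kernel of \<open>M\<close> and keeps its support.
\<close>

section \<open>Short even edge sets in dense multigraphs\<close>

lemma even_card_sym_diff:
  assumes "finite A" "finite B"
  shows "even (card ((A - B) \<union> (B - A))) \<longleftrightarrow> (even (card A) \<longleftrightarrow> even (card B))"
proof -
  have "card A = card (A - B) + card (A \<inter> B)" "card B = card (B - A) + card (A \<inter> B)"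
    using assms by (metis Int_commute card_Int_Diff add.commute)+
  moreover have "card ((A - B) \<union> (B - A)) = card (A - B) + card (B - A)"
    using assms by (intro card_Un_disjoint) auto
  ultimately show ?thesis by (metis even_add)
qed

text \<open>A multigraph is given by the two end maps \<open>f\<close> and \<open>g\<close> of its
  edges. A loop counts twice, so loops do not affect degree parities.\<close>

definition edge_degree :: "('e \<Rightarrow> 'b) \<Rightarrow> ('e \<Rightarrow> 'b) \<Rightarrow> 'e set \<Rightarrow> 'b \<Rightarrow> nat" where
  "edge_degree f g D b = card {e \<in> D. f e = b} + card {e \<in> D. g e = b}"

text \<open>Degree parities are linear over the two-element field, where symmetric difference is the
  addition of edge sets.\<close>

lemma even_edge_degree_sym_diff:
  assumes "finite A" "finite B"
  shows "even (edge_degree f g ((A - B) \<union> (B - A)) b) \<longleftrightarrow>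
    (even (edge_degree f g A b) \<longleftrightarrow> even (edge_degree f g B b))"
proof -
  have "{e \<in> (A - B) \<union> (B - A). h e = b} =
    ({e \<in> A. h e = b} - {e \<in> B. h e = b}) \<union> ({e \<in> B. h e = b} - {e \<in> A. h e = b})" for h :: "'a \<Rightarrow> 'b"
    by auto
  then show ?thesis
    using assms by (auto simp: edge_degree_def even_card_sym_diff)
qed

lemma even_edge_degree_insert:
  assumes "finite A" "e \<notin> A"
  shows "even (edge_degree f g (insert e A) b) \<longleftrightarrow>
    (even (edge_degree f g A b) \<longleftrightarrow> (f e = b \<longleftrightarrow> g e = b))"
proof -
  have *: "card {x \<in> insert e A. h x = b} = card {x \<in> A. h x = b} + of_bool (h e = b)" for h :: "'a \<Rightarrow> 'b"
  proof (cases "h e = b")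
    case True
    then have "{x \<in> insert e A. h x = b} = insert e {x \<in> A. h x = b}" by auto
    then show ?thesis using True assms by simp
  next
    case False
    then have "{x \<in> insert e A. h x = b} = {x \<in> A. h x = b}" by auto
    then show ?thesis using False by simp
  qed
  show ?thesis unfolding edge_degree_def * by auto
qed

text \<open>\<open>T\<close> is the ball of radius \<open>d\<close> around \<open>r\<close>, \<open>Tr\<close> a spanning tree of it and \<open>p y\<close> the tree path
  from \<open>r\<close> to \<open>y\<close>. An edge inside the ball but outside the tree, or two edges leaving the ball to the
  same vertex, would close a short cycle; hence more than \<open>card T\<close> new vertices are reached.\<close>

lemma ball_growth:
  fixes f g :: "'e \<Rightarrow> 'b"
  assumes fin: "finite E" "finite B" and r: "r \<in> B" and ends: "f ` E \<subseteq> B" "g ` E \<subseteq> B"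
    and touch: "\<And>U. U \<subseteq> B \<Longrightarrow> U \<noteq> {} \<Longrightarrow> 2 * card U \<le> card {e \<in> E. f e \<in> U \<or> g e \<in> U}"
    and no_even: "\<forall>D. D \<subseteq> E \<and> D \<noteq> {} \<and> card D \<le> 2 * d \<longrightarrow> (\<exists>b. odd (edge_degree f g D b))"
  shows "\<exists>T Tr p. T \<subseteq> B \<and> r \<in> T \<and> 2 ^ d \<le> card T \<and> Tr \<subseteq> E \<and> card Tr < card T \<and>
    f ` Tr \<subseteq> T \<and> g ` Tr \<subseteq> T \<and>
    (\<forall>y\<in>T. p y \<subseteq> Tr \<and> card (p y) \<le> d \<and> (\<forall>b. odd (edge_degree f g (p y) b) \<longleftrightarrow> (b = r) \<noteq> (b = y)))"
  using no_even
proof (induction d)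
  case 0
  show ?case
    by (rule exI[of _ "{r}"], rule exI[of _ "{}"], rule exI[of _ "\<lambda>_. {}"])
      (use r in \<open>auto simp: edge_degree_def\<close>)
next
  case (Suc d)
  have "\<forall>D. D \<subseteq> E \<and> D \<noteq> {} \<and> card D \<le> 2 * d \<longrightarrow> (\<exists>b. odd (edge_degree f g D b))"
    using Suc.prems by auto
  from Suc.IH[OF this] obtain T Tr p where T: "T \<subseteq> B" "r \<in> T" "2 ^ d \<le> card T" "Tr \<subseteq> E" "card Tr < card T"
    "f ` Tr \<subseteq> T" "g ` Tr \<subseteq> T" and p: "\<forall>y\<in>T. p y \<subseteq> Tr \<and> card (p y) \<le> d \<and>
      (\<forall>b. odd (edge_degree f g (p y) b) \<longleftrightarrow> (b = r) \<noteq> (b = y))"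
    by (elim exE conjE) (rule that)
  have p: "p y \<subseteq> Tr" "card (p y) \<le> d" "even (edge_degree f g (p y) b) \<longleftrightarrow> (b = r) = (b = y)"
    if "y \<in> T" for y b
    using p that by blast+
  have finT: "finite T" "finite Tr" using T fin finite_subset by metis+
  have finp: "finite (p y)" if "y \<in> T" for y using p(1)[OF that] finT finite_subset by blast
  \<comment> \<open>The common part of the two tree paths cancels, which leaves an edge set with odd
    degree exactly at \<open>y\<close> and \<open>z\<close>, and nowhere if
    \<open>y = z\<close>.\<close>
  define join where "join y z = (p y - p z) \<union> (p z - p y)" for y z
  have join_fin: "finite (join y z)" if "y \<in> T" "z \<in> T" for y z
    using that finp by (auto simp: join_def)
  have join_sub: "join y z \<subseteq> Tr" if "y \<in> T" "z \<in> T" for y z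
    using that p(1) by (auto simp: join_def)
  have join_card: "card (join y z) \<le> 2 * d" if "y \<in> T" "z \<in> T" for y z
  proof -
    have "card (join y z) \<le> card (p y \<union> p z)"
      unfolding join_def by (rule card_mono) (use that finp in auto)
    also have "\<dots> \<le> card (p y) + card (p z)" by (rule card_Un_le)
    finally show ?thesis using p(2)[OF that(1)] p(2)[OF that(2)] by simp
  qed
  have join_even: "even (edge_degree f g (join y z) b) \<longleftrightarrow> (b = y) = (b = z)" if "y \<in> T" "z \<in> T" for y z b
    unfolding join_def using that by (auto simp: even_edge_degree_sym_diff finp p(3))
  \<comment> \<open>A non-tree edge inside the ball, with the join of its ends, would be an even set
    of at most \<open>2 * d + 1\<close> edges.\<close>
  have inside: "{e \<in> E. f e \<in> T \<and> g e \<in> T} \<subseteq> Tr"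
  proof (rule ccontr)
    assume "\<not> ?thesis"
    then obtain e where e: "e \<in> E" "f e \<in> T" "g e \<in> T" "e \<notin> Tr" by auto
    let ?D = "insert e (join (f e) (g e))"
    have nin: "e \<notin> join (f e) (g e)" using join_sub e by blast
    have "?D \<subseteq> E" using e join_sub T(4) by blast
    moreover have "card ?D \<le> 2 * Suc d"
      using join_card[OF e(2,3)] nin join_fin[OF e(2,3)] by simp
    moreover have "even (edge_degree f g ?D b)" for b
      using e nin join_fin[OF e(2,3)] by (auto simp: even_edge_degree_insert join_even)
    ultimately show False using Suc.prems by blast
  qed
  define L where "L = {e \<in> E. (f e \<in> T) \<noteq> (g e \<in> T)}"
  define inn where "inn e = (if f e \<in> T then f e else g e)" for e
  define out where "out e = (if f e \<in> T then g e else f e)" for e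
  have L: "inn e \<in> T" "out e \<in> B - T" "e \<in> E" "e \<notin> Tr" "(f e = b) = (g e = b) \<longleftrightarrow> (b = inn e) = (b = out e)"
    if "e \<in> L" for e b
    using that T ends unfolding L_def inn_def out_def by (auto split: if_splits)
  have finL: "finite L" using fin by (simp add: L_def)
  \<comment> \<open>Two edges to the same outer vertex, with the join of their inner ends, would be
    an even set of at most \<open>2 * d + 2\<close> edges.\<close>
  have inj: "inj_on out L"
  proof (rule inj_onI, rule ccontr)
    fix e e' assume ee: "e \<in> L" "e' \<in> L" "out e = out e'" "e \<noteq> e'"
    let ?J = "join (inn e) (inn e')" and ?D = "insert e (insert e' (join (inn e) (inn e')))"
    have nin: "e \<notin> insert e' ?J" "e' \<notin> ?J" using join_sub L ee by blast+
    have finJ: "finite ?J" using join_fin L ee by blast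
    have "?D \<subseteq> E" using join_sub T(4) L ee by blast
    moreover have "card ?D \<le> 2 * Suc d"
      using join_card[of "inn e" "inn e'"] nin finJ L ee by simp
    moreover have "even (edge_degree f g ?D b)" for b
    proof -
      have "even (edge_degree f g ?D b) \<longleftrightarrow>
          (((b = inn e) = (b = inn e')) = ((f e' = b) = (g e' = b))) = ((f e = b) = (g e = b))"
        using nin finJ L ee by (simp add: even_edge_degree_insert join_even)
      then show ?thesis using L(5)[OF ee(1), of b] L(5)[OF ee(2), of b] L(1,2)[OF ee(1)] L(1,2)[OF ee(2)] ee(3)
        by auto
    qed
    ultimately show False using Suc.prems by blast
  qed
  \<comment> \<open>At least \<open>2 * card T\<close> edges touch the ball, and fewer than
    \<open>card T\<close> of them lie inside, since those belong to the tree.\<close>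
  have cL: "card T < card L"
  proof -
    have "{e \<in> E. f e \<in> T \<or> g e \<in> T} = {e \<in> E. f e \<in> T \<and> g e \<in> T} \<union> L" by (auto simp: L_def)
    then have "2 * card T \<le> card {e \<in> E. f e \<in> T \<and> g e \<in> T} + card L"
      using touch[OF T(1)] T(2) card_Un_le[of "{e \<in> E. f e \<in> T \<and> g e \<in> T}" L] by fastforce
    moreover have "card {e \<in> E. f e \<in> T \<and> g e \<in> T} \<le> card Tr"
      using inside finT by (intro card_mono)
    ultimately show ?thesis using T(5) by linarith
  qed
  let ?T = "T \<union> out ` L" and ?Tr = "Tr \<union> L"
  \<comment> \<open>A new vertex is reached by the unique edge of \<open>L\<close> leading to it,
    appended to the path of its inner end.\<close>
  define q where "q y = (if y \<in> T then p y else (let e = inv_into L out y in insert e (p (inn e))))" for y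
  have cT: "card ?T = card T + card L"
    using finT finL L by (subst card_Un_disjoint) (auto simp: card_image[OF inj])
  show ?case
  proof (intro exI conjI ballI allI)
    show "?T \<subseteq> B" "r \<in> ?T" "?Tr \<subseteq> E" using T L by auto
    show "2 ^ Suc d \<le> card ?T" using cT cL T(3) by simp
    show "card ?Tr < card ?T" using cT T(5) card_Un_le[of Tr L] by linarith
    show "f ` ?Tr \<subseteq> ?T" "g ` ?Tr \<subseteq> ?T" using T(6,7) by (auto simp: L_def out_def split: if_splits)
    fix y assume y: "y \<in> ?T"
    show "q y \<subseteq> ?Tr" "card (q y) \<le> Suc d" 
      "\<And>b. odd (edge_degree f g (q y) b) \<longleftrightarrow> (b = r) \<noteq> (b = y)"
    proof (atomize(full), cases "y \<in> T")
      case True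
      then show "q y \<subseteq> ?Tr \<and> card (q y) \<le> Suc d \<and> (\<forall>b. odd (edge_degree f g (q y) b) \<longleftrightarrow> (b = r) \<noteq> (b = y))"
        using p[of y] by (auto simp: q_def)
    next
      case False
      then obtain e where e: "e \<in> L" "y = out e" using y by auto
      then have q: "q y = insert e (p (inn e))" using False inj by (simp add: q_def Let_def)
      have nin: "e \<notin> p (inn e)" and fi: "finite (p (inn e))"
        using L(1,4)[OF e(1)] p(1) finp by blast+
      have "q y \<subseteq> ?Tr" using e(1) q p(1)[OF L(1)[OF e(1)]] by auto
      moreover have "card (q y) \<le> Suc d" using q nin p(2)[OF L(1)[OF e(1)]] fi by simp
      moreover have "odd (edge_degree f g (q y) b) \<longleftrightarrow> (b = r) \<noteq> (b = y)" for b
        unfolding q using nin L(5)[OF e(1), of b] L(1,2)[OF e(1)] e(2) fi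
        by (simp add: even_edge_degree_insert p(3)) blast
      ultimately show "q y \<subseteq> ?Tr \<and> card (q y) \<le> Suc d \<and> (\<forall>b. odd (edge_degree f g (q y) b) \<longleftrightarrow> (b = r) \<noteq> (b = y))"
        by blast
    qed
  qed
qed

text \<open>Without such a set, balls in a suitable dense subgraph at least double with each step,
  so a ball of radius \<open>d\<close> would have \<open>2 ^ d\<close> vertices, more than
  \<open>B\<close> has.\<close>

lemma short_even_edge_set:
  fixes f g :: "'e \<Rightarrow> 'b"
  assumes fin: "finite E" "finite B" and ends: "f ` E \<subseteq> B" "g ` E \<subseteq> B"
    and B: "B \<noteq> {}" "2 * card B \<le> card E" "card B < 2 ^ d"
  shows "\<exists>D\<subseteq>E. D \<noteq> {} \<and> card D \<le> 2 * d \<and> (\<forall>b. even (edge_degree f g D b))"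
proof (rule ccontr)
  assume contra: "\<not> ?thesis"
  define ins where "ins U = {e \<in> E. f e \<in> U \<and> g e \<in> U}" for U
  define Q where "Q U \<longleftrightarrow> U \<subseteq> B \<and> U \<noteq> {} \<and> 2 * card U \<le> card (ins U)" for U
  have "ins B = E" using ends by (auto simp: ins_def)
  then have "Q B" using B by (simp add: Q_def)
  \<comment> \<open>in a minimal vertex set of density at least \<open>2\<close>, every \<open>U\<close> touches at least \<open>2 * card U\<close> edges,
    since otherwise \<open>U\<close> could be removed\<close>
  define A where "A = (ARG_MIN card U. Q U)"
  have QA: "Q A" and minA: "\<And>U. Q U \<Longrightarrow> card A \<le> card U"
    unfolding A_def using arg_min_nat_lemma[of Q B card] \<open>Q B\<close> by auto
  have A: "A \<subseteq> B" "A \<noteq> {}" "2 * card A \<le> card (ins A)" using QA by (auto simp: Q_def)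
  have finA: "finite A" using A fin finite_subset by metis
  obtain r where r: "r \<in> A" using A by blast
  have touch: "2 * card U \<le> card {e \<in> ins A. f e \<in> U \<or> g e \<in> U}" if U: "U \<subseteq> A" "U \<noteq> {}" for U
  proof (cases "U = A")
    case True
    then have "{e \<in> ins A. f e \<in> U \<or> g e \<in> U} = ins A" by (auto simp: ins_def)
    then show ?thesis using A True by simp
  next
    case False
    have finU: "finite U" using finA U finite_subset by metis
    have "card (A - U) < card A" using U finA by (intro psubset_card_mono) auto
    then have "\<not> Q (A - U)" using minA[of "A - U"] by auto
    then have 1: "card (ins (A - U)) < 2 * card (A - U)" using A False U by (auto simp: Q_def)
    have "ins A = ins (A - U) \<union> {e \<in> ins A. f e \<in> U \<or> g e \<in> U}" by (auto simp: ins_def)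
    then have "card (ins A) \<le> card (ins (A - U)) + card {e \<in> ins A. f e \<in> U \<or> g e \<in> U}"
      by (metis card_Un_le)
    then show ?thesis using 1 A(3) card_Diff_subset[OF finU U(1)] card_mono[OF finA U(1)] by linarith
  qed
  have "\<exists>T Tr p. T \<subseteq> A \<and> r \<in> T \<and> 2 ^ d \<le> card T \<and> Tr \<subseteq> ins A \<and> card Tr < card T \<and>
    f ` Tr \<subseteq> T \<and> g ` Tr \<subseteq> T \<and>
    (\<forall>y\<in>T. p y \<subseteq> Tr \<and> card (p y) \<le> d \<and> (\<forall>b. odd (edge_degree f g (p y) b) \<longleftrightarrow> (b = r) \<noteq> (b = y)))"
  proof (rule ball_growth[OF _ finA r _ _ touch])
    show "finite (ins A)" "f ` ins A \<subseteq> A" "g ` ins A \<subseteq> A" using fin by (auto simp: ins_def)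
    show "\<forall>D. D \<subseteq> ins A \<and> D \<noteq> {} \<and> card D \<le> 2 * d \<longrightarrow> (\<exists>b. odd (edge_degree f g D b))"
      using contra by (auto simp: ins_def)
  qed
  then obtain T where "T \<subseteq> A" "2 ^ d \<le> card T" by (elim exE conjE) (rule that)
  then have "2 ^ d \<le> card B" using card_mono[OF fin(2), of T] A(1) by fastforce
  then show False using B(3) by simp
qed

section \<open>Packing generators of double occurrence words\<close>

text \<open>The product of the graph state generators over \<open>D\<close> has its X parts on
  \<open>D\<close> and its Z parts on the vertices with odd neighbour count; see
  \<open>supp_generator_string\<close>.\<close>

definition generator_support :: "'v set \<Rightarrow> 'v rel \<Rightarrow> 'v set \<Rightarrow> 'v set" where
  "generator_support V H D = {v \<in> V. v \<in> D \<or> odd (card {u \<in> D. (u, v) \<in> H})}"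

text \<open>\<open>a v\<close> and \<open>b v\<close> are the positions of the first and the second occurrence of the letter \<open>v\<close>.\<close>

definition double_occurrence_word :: "'v set \<Rightarrow> 'v rel \<Rightarrow> ('v \<Rightarrow> nat) \<Rightarrow> ('v \<Rightarrow> nat) \<Rightarrow> bool" where
  "double_occurrence_word V H a b \<longleftrightarrow>
     inj_on a V \<and> inj_on b V \<and> a ` V \<inter> b ` V = {} \<and>
     (\<forall>v\<in>V. a v < b v \<and> b v < 2 * card V) \<and>
     (\<forall>u\<in>V. \<forall>v\<in>V. u \<noteq> v \<longrightarrow>
        ((u, v) \<in> H \<longleftrightarrow> (a u < a v \<and> a v < b u \<and> b u < b v) \<or> (a v < a u \<and> a u < b v \<and> b v < b u)))"

text \<open>With blocks of length \<open>8\<close> there are about \<open>n / 4\<close> blocks for \<open>n\<close> letters, so that the density is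
  still at least \<open>2\<close> after the deletion of all blocks met by \<open>n / 64\<close> letters.\<close>

definition letters_of_blocks :: "'v set \<Rightarrow> ('v \<Rightarrow> nat) \<Rightarrow> ('v \<Rightarrow> nat) \<Rightarrow> nat set \<Rightarrow> 'v set" where
  "letters_of_blocks V a b C = {v \<in> V. a v div 8 \<in> C \<or> b v div 8 \<in> C}"

lemma card_filter_fibres:
  assumes "finite D" "finite C"
  shows "card {u \<in> D. f u \<in> C} = (\<Sum>c\<in>C. card {u \<in> D. f u = c})"
proof -
  have "{u \<in> D. f u \<in> C} = (\<Union>c\<in>C. {u \<in> D. f u = c})" by auto
  also have "card \<dots> = (\<Sum>c\<in>C. card {u \<in> D. f u = c})"
    using assms by (intro card_UN_disjoint) auto
  finally show ?thesis .
qed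

text \<open>A letter counted here occupies at least one of the 8 positions of some block in
  \<open>C\<close>, and no two occurrences share a position.\<close>

lemma card_letters_of_blocks:
  assumes w: "double_occurrence_word V H a b" and fin: "finite V" "finite C"
  shows "card (letters_of_blocks V a b C) \<le> 8 * card C"
proof -
  have one: "card (letters_of_blocks V a b {c}) \<le> 8" for c
  proof -
    let ?A = "{v \<in> V. a v div 8 = c}" and ?B = "{v \<in> V. b v div 8 = c}"
    have "letters_of_blocks V a b {c} = ?A \<union> ?B" by (auto simp: letters_of_blocks_def)
    then have "card (letters_of_blocks V a b {c}) \<le> card ?A + card ?B" by (simp add: card_Un_le)
    also have "card ?A = card (a ` ?A)"
      using w by (intro card_image[symmetric]) (auto simp: double_occurrence_word_def intro: inj_on_subset)
    also have "card ?B = card (b ` ?B)"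
      using w by (intro card_image[symmetric]) (auto simp: double_occurrence_word_def intro: inj_on_subset)
    also have "card (a ` ?A) + card (b ` ?B) = card (a ` ?A \<union> b ` ?B)"
      using w fin by (intro card_Un_disjoint[symmetric]) (auto simp: double_occurrence_word_def)
    also have "\<dots> \<le> card {8 * c..<8 * c + 8}" by (intro card_mono) auto
    finally show ?thesis by simp
  qed
  have "letters_of_blocks V a b C = (\<Union>c\<in>C. letters_of_blocks V a b {c})"
    by (auto simp: letters_of_blocks_def)
  then have "card (letters_of_blocks V a b C) \<le> (\<Sum>c\<in>C. card (letters_of_blocks V a b {c}))"
    using card_UN_le[OF fin(2)] by metis
  also have "\<dots> \<le> (\<Sum>c\<in>C. 8)" by (intro sum_mono one)
  finally show ?thesis by simp
qed

text \<open>The exclusive-or form turns a count of interlaced letters, modulo 2, into a count of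
  single occurrences inside an interval.\<close>

lemma interlaced_iff:
  fixes x y x' y' :: "'a::linorder"
  assumes "x < y" "x' < y'" "x \<noteq> x'" "x \<noteq> y'" "y \<noteq> x'" "y \<noteq> y'"
  shows "(x < x' \<and> x' < y \<and> y < y') \<or> (x' < x \<and> x < y' \<and> y' < y) \<longleftrightarrow>
    (x' < x \<and> x < y') \<noteq> (x' < y \<and> y < y')"
  using assms by (cases "x < x'"; cases "x' < y"; cases "y < y'"; cases "x < y'") auto

text \<open>For a letter \<open>v\<close> sharing no block with \<open>D\<close>, the number of its
  neighbours in \<open>D\<close> has the parity of the total degree of the blocks strictly between
  the two blocks of \<open>v\<close>, and every single degree is even.\<close>

lemma generator_support_subset_letters:
  assumes w: "double_occurrence_word V H a b" and D: "finite D" "D \<subseteq> V"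
    and ev: "\<And>c. even (edge_degree (\<lambda>v. a v div 8) (\<lambda>v. b v div 8) D c)"
  shows "generator_support V H D \<subseteq>
    letters_of_blocks V a b ((\<lambda>v. a v div 8) ` D \<union> (\<lambda>v. b v div 8) ` D)"
proof (rule ccontr)
  define f g where "f = (\<lambda>v. a v div 8)" and "g = (\<lambda>v. b v div 8)"
  assume "\<not> ?thesis"
  then obtain v where v: "v \<in> V" "v \<in> D \<or> odd (card {u \<in> D. (u, v) \<in> H})"
    "f v \<notin> f ` D \<union> g ` D" "g v \<notin> f ` D \<union> g ` D"
    by (auto simp: generator_support_def letters_of_blocks_def f_def g_def)
  then have "v \<notin> D" by auto
  let ?I = "{f v<..<g v}"
  \<comment> \<open>A position outside both blocks of \<open>v\<close> is compared with the
    occurrences of \<open>v\<close> by block numbers alone.\<close>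
  have between: "a v < k \<and> k < b v \<longleftrightarrow> k div 8 \<in> ?I" if "k div 8 \<noteq> f v" "k div 8 \<noteq> g v" for k
    using that div_le_mono[of "a v" k 8] div_le_mono[of k "a v" 8] div_le_mono[of k "b v" 8]
      div_le_mono[of "b v" k 8] unfolding f_def g_def by auto
  have adj: "(u, v) \<in> H \<longleftrightarrow> (f u \<in> ?I) \<noteq> (g u \<in> ?I)" if u: "u \<in> D" for u
  proof -
    have ne: "f u \<noteq> f v" "f u \<noteq> g v" "g u \<noteq> f v" "g u \<noteq> g v"
      using v(3,4) imageI[OF u, of f] imageI[OF u, of g] by auto
    have "u \<in> V" "u \<noteq> v" using u D \<open>v \<notin> D\<close> by auto
    moreover have "a u \<noteq> a v" "a u \<noteq> b v" "b u \<noteq> a v" "b u \<noteq> b v"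
      using ne by (auto simp: f_def g_def)
    moreover have "(u, v) \<in> H \<longleftrightarrow>
        (a u < a v \<and> a v < b u \<and> b u < b v) \<or> (a v < a u \<and> a u < b v \<and> b v < b u)"
      "a u < b u" "a v < b v"
      using w v(1) \<open>u \<in> V\<close> \<open>u \<noteq> v\<close> unfolding double_occurrence_word_def by blast+
    ultimately have "(u, v) \<in> H \<longleftrightarrow> (a v < a u \<and> a u < b v) \<noteq> (a v < b u \<and> b u < b v)"
      using interlaced_iff[of "a u" "b u" "a v" "b v"] by blast
    also have "a v < a u \<and> a u < b v \<longleftrightarrow> f u \<in> ?I"
      using between[of "a u"] ne unfolding f_def g_def by blast
    also have "a v < b u \<and> b u < b v \<longleftrightarrow> g u \<in> ?I"
      using between[of "b u"] ne unfolding f_def g_def by blast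
    finally show ?thesis .
  qed
  have "{u \<in> D. (u, v) \<in> H} =
    ({u \<in> D. f u \<in> ?I} - {u \<in> D. g u \<in> ?I}) \<union> ({u \<in> D. g u \<in> ?I} - {u \<in> D. f u \<in> ?I})"
    using adj by blast
  then have "even (card {u \<in> D. (u, v) \<in> H}) \<longleftrightarrow>
      even (card {u \<in> D. f u \<in> ?I} + card {u \<in> D. g u \<in> ?I})"
    using D by (simp add: even_card_sym_diff)
  \<comment> \<open>Both counts are sorted by block, so that each block contributes its
    degree.\<close>
  also have "card {u \<in> D. f u \<in> ?I} + card {u \<in> D. g u \<in> ?I} = (\<Sum>c\<in>?I. edge_degree f g D c)"
    using D by (simp add: card_filter_fibres edge_degree_def sum.distrib del: greaterThanLessThan_iff)
  also have "even \<dots>" using ev by (intro dvd_sum) (simp add: f_def g_def)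
  finally show False using v(2) \<open>v \<notin> D\<close> by simp
qed

text \<open>All blocks met by \<open>W\<close> are deleted, together with the letters having an
  occurrence there. The remaining multigraph is still dense enough for a short even edge set, whose
  support stays among letters meeting surviving blocks.\<close>

lemma short_generator_avoiding:
  assumes w: "double_occurrence_word V H a b" and fin: "finite V"
    and n: "8 \<le> card V" "card V < 2 ^ d" and W: "W \<subseteq> V" "64 * card W \<le> card V"
  shows "\<exists>D\<subseteq>V. D \<noteq> {} \<and> generator_support V H D \<inter> W = {} \<and> card (generator_support V H D) \<le> 32 * d"
proof -
  define f g where "f = (\<lambda>v. a v div 8)" and "g = (\<lambda>v. b v div 8)"
  define bad where "bad = f ` W \<union> g ` W"
  \<comment> \<open>Positions are below \<open>2 * card V\<close>, so block numbers are at most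
    \<open>card V div 4\<close>.\<close>
  define B where "B = {..card V div 4} - bad"
  define E where "E = V - letters_of_blocks V a b bad"
  have finW: "finite W" using W fin finite_subset by metis
  have two: "card (f ` X \<union> g ` X) \<le> 2 * card X" if "finite X" for X
    using that card_Un_le[of "f ` X" "g ` X"] card_image_le[of X f] card_image_le[of X g] by linarith
  have "card (letters_of_blocks V a b bad) \<le> 8 * card bad"
    using w fin finW by (intro card_letters_of_blocks) (auto simp: bad_def)
  also have "\<dots> \<le> 16 * card W" using two[OF finW] by (simp add: bad_def)
  finally have "card (letters_of_blocks V a b bad) \<le> 16 * card W" .
  moreover have "letters_of_blocks V a b bad \<subseteq> V" by (auto simp: letters_of_blocks_def)
  ultimately have "card V - 16 * card W \<le> card E"
    using finite_subset[OF _ fin] by (simp add: E_def card_Diff_subset)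
  moreover have cB: "card B \<le> card V div 4 + 1"
    using card_mono[of "{..card V div 4}" B] by (auto simp: B_def)
  \<comment> \<open>\<open>card E\<close> is at least three quarters of \<open>card V\<close>, while
    \<open>2 * card B\<close> is at most \<open>card V / 2 + 2\<close>; the first dominates from
    \<open>card V = 8\<close> on.\<close>
  ultimately have EB: "2 * card B \<le> card E" "0 < card E" "card B < 2 ^ d" using n W(2) by linarith+
  have lt: "f v \<le> card V div 4" "g v \<le> card V div 4" if "v \<in> V" for v
    using w that unfolding double_occurrence_word_def f_def g_def by (auto dest!: bspec)
  have fE: "f ` E \<subseteq> B" "g ` E \<subseteq> B"
    using lt by (auto simp: E_def B_def letters_of_blocks_def f_def g_def)
  have "E \<noteq> {}" using EB(2) by auto
  then have "finite E" "finite B" "B \<noteq> {}" using fin fE(1) by (auto simp: E_def B_def)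
  from short_even_edge_set[OF this(1,2) fE this(3) EB(1,3)] obtain D where
    D: "D \<subseteq> E" "D \<noteq> {}" "card D \<le> 2 * d" "\<And>c. even (edge_degree f g D c)" by blast
  have DV: "D \<subseteq> V" "finite D" using D(1) fin finite_subset by (auto simp: E_def)
  let ?L = "letters_of_blocks V a b (f ` D \<union> g ` D)"
  have sub: "generator_support V H D \<subseteq> ?L"
    using generator_support_subset_letters[OF w DV(2,1)] D(4) by (simp add: f_def g_def)
  have "f ` D \<subseteq> B" "g ` D \<subseteq> B" using fE by (meson D(1) image_mono order_trans)+
  moreover have "B \<inter> bad = {}" by (auto simp: B_def)
  ultimately have "(f ` D \<union> g ` D) \<inter> bad = {}" by (simp add: Int_Un_distrib2) fast
  moreover have "f v \<in> bad" "g v \<in> bad" if "v \<in> W" for v using that by (simp_all add: bad_def)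
  moreover have "f v \<in> f ` D \<union> g ` D \<or> g v \<in> f ` D \<union> g ` D" if "v \<in> ?L" for v
    using that by (simp add: letters_of_blocks_def f_def g_def)
  ultimately have "?L \<inter> W = {}" by (metis disjoint_iff)
  \<comment> \<open>At most \<open>2 * d\<close> letters meet at most \<open>4 * d\<close> blocks,
    each with at most 8 letters.\<close>
  moreover have "card ?L \<le> 32 * d"
    using card_letters_of_blocks[OF w fin, of "f ` D \<union> g ` D"] two[OF DV(2)] D(3) DV(2) by simp
  moreover have "card (generator_support V H D) \<le> card ?L"
    using sub fin by (intro card_mono) (auto simp: letters_of_blocks_def)
  ultimately show ?thesis using sub D(2) DV by (intro exI[of _ D]) auto
qed

text \<open>Greedy choice: \<open>m\<close> earlier supports cover at most \<open>32 * d * m\<close>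
  letters, and \<open>64 * 32 = 2048\<close>, so the next set can avoid them all.\<close>

lemma word_generator_packing:
  assumes w: "double_occurrence_word V H a b" and fin: "finite V"
    and n: "8 \<le> card V" "card V < 2 ^ d" and m: "2048 * d * m \<le> card V"
  shows "\<exists>D::nat \<Rightarrow> 'v set. (\<forall>i<m. D i \<subseteq> V \<and> D i \<noteq> {} \<and> card (generator_support V H (D i)) \<le> 32 * d) \<and>
    (\<forall>i<m. \<forall>j<m. i \<noteq> j \<longrightarrow> generator_support V H (D i) \<inter> generator_support V H (D j) = {})"
  using m
proof (induction m)
  case 0
  then show ?case by simp
next
  case (Suc m)
  then have "2048 * d * m \<le> card V" by simp
  from Suc.IH[OF this] obtain D :: "nat \<Rightarrow> 'v set" where
    D: "\<forall>i<m. D i \<subseteq> V \<and> D i \<noteq> {} \<and> card (generator_support V H (D i)) \<le> 32 * d"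
      "\<forall>i<m. \<forall>j<m. i \<noteq> j \<longrightarrow> generator_support V H (D i) \<inter> generator_support V H (D j) = {}"
    by (elim exE conjE) (rule that)
  let ?W = "\<Union>i<m. generator_support V H (D i)"
  have "card ?W \<le> (\<Sum>i<m. card (generator_support V H (D i)))" by (intro card_UN_le) simp
  also have "\<dots> \<le> (\<Sum>i<m. 32 * d)" using D(1) by (intro sum_mono) simp
  finally have "card ?W \<le> 32 * (d * m)" by (simp add: mult.left_commute mult.commute)
  then have "64 * card ?W \<le> card V" using Suc.prems by (simp add: algebra_simps)
  moreover have "?W \<subseteq> V" by (auto simp: generator_support_def)
  ultimately obtain D' where D': "D' \<subseteq> V" "D' \<noteq> {}" "generator_support V H D' \<inter> ?W = {}"
    "card (generator_support V H D') \<le> 32 * d"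
    using short_generator_avoiding[OF w fin n] by metis
  show ?case
    by (rule exI[of _ "D(m := D')"]) (use D D' in \<open>auto simp: less_Suc_eq\<close>)
qed

section \<open>Low-rank perturbations\<close>

text \<open>Over the two-element field every linear combination is the sum of a subset.\<close>

lemma bit_fun_card_span_le:
  fixes B :: "('v \<Rightarrow> bit) set"
  assumes "finite B"
  shows "finite (bit_fun.span B) \<and> card (bit_fun.span B) \<le> 2 ^ card B"
proof -
  have "bit_fun.span B \<subseteq> (\<lambda>X. \<Sum>f\<in>X. f) ` Pow B"
  proof
    fix x assume "x \<in> bit_fun.span B"
    then obtain c where x: "x = (\<Sum>f\<in>B. (\<lambda>v. c f * f v))"
      using bit_fun.span_finite[OF assms] by auto
    also have "\<dots> = (\<Sum>f\<in>B. if c f = 1 then f else 0)"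
      by (intro sum.cong refl) (auto simp: fun_eq_iff)
    also have "\<dots> = (\<Sum>f\<in>{f \<in> B. c f = 1}. f)"
      using assms by (simp add: sum.inter_filter)
    finally show "x \<in> (\<lambda>X. \<Sum>f\<in>X. f) ` Pow B" by (intro image_eqI[of _ _ "{f \<in> B. c f = 1}"]) auto
  qed
  moreover have "finite ((\<lambda>X. \<Sum>f\<in>X. f) ` Pow B)" using assms by simp
  moreover have "card ((\<lambda>X. \<Sum>f\<in>X. f) ` Pow B) \<le> 2 ^ card B"
    using assms card_image_le[of "Pow B" "\<lambda>X. \<Sum>f\<in>X. f"] by (simp add: card_Pow)
  ultimately show ?thesis by (meson card_mono finite_subset le_trans)
qed

text \<open>Pigeonhole: all these row sums lie in the row space, which has at most
  \<open>2 ^ p\<close> vectors.\<close>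

lemma equal_row_sums:
  fixes M :: "'v \<Rightarrow> 'v \<Rightarrow> bit" and D :: "nat \<Rightarrow> 'v set"
  assumes "finite V" "bit_rank V M \<le> p" "finite I" "2 ^ p < card I" "\<And>i. i \<in> I \<Longrightarrow> D i \<subseteq> V"
  shows "\<exists>i\<in>I. \<exists>j\<in>I. i \<noteq> j \<and> (\<forall>v\<in>V. (\<Sum>u\<in>D i. M u v) = (\<Sum>u\<in>D j. M u v))"
proof -
  define R where "R = (\<lambda>u v. if v \<in> V then M u v else 0)"
  obtain B where B: "B \<subseteq> R ` V" "R ` V \<subseteq> bit_fun.span B" "card B = bit_fun.dim (R ` V)"
    using bit_fun.basis_exists[of "R ` V"] by metis
  have "finite B" using B(1) assms(1) finite_surj by blast
  moreover have "card B \<le> p" using B(3) assms(2) by (simp add: bit_rank_def R_def)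
  ultimately have S: "finite (bit_fun.span B)" "card (bit_fun.span B) \<le> 2 ^ p"
    using bit_fun_card_span_le[of B] power_increasing[of "card B" p "2::nat"] by (metis le_trans one_le_numeral)+
  have "(\<lambda>i. \<Sum>u\<in>D i. R u) ` I \<subseteq> bit_fun.span B"
    using B(2) assms(5) by (fastforce intro!: bit_fun.span_sum)
  then have "card ((\<lambda>i. \<Sum>u\<in>D i. R u) ` I) < card I"
    using S assms(4) card_mono[OF S(1)] by (meson le_less_trans)
  then obtain i j where ij: "i \<in> I" "j \<in> I" "i \<noteq> j" "(\<Sum>u\<in>D i. R u) = (\<Sum>u\<in>D j. R u)"
    using pigeonhole[of "\<lambda>i. \<Sum>u\<in>D i. R u" I] by (auto simp: inj_on_def)
  have "(\<Sum>u\<in>X. R u) v = (\<Sum>u\<in>X. R u v)" for X v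
    by (induction X rule: infinite_finite_induct) auto
  then have "(\<Sum>u\<in>D i. R u v) = (\<Sum>u\<in>D j. R u v)" for v using ij(4) by metis
  moreover have "(\<Sum>u\<in>X. R u v) = (\<Sum>u\<in>X. M u v)" if "v \<in> V" for X v
    using that by (intro sum.cong) (simp_all add: R_def)
  ultimately have "\<forall>v\<in>V. (\<Sum>u\<in>D i. M u v) = (\<Sum>u\<in>D j. M u v)" by metis
  then show ?thesis using ij by blast
qed

lemma sum_adjacency_eq_0_iff:
  assumes "finite X"
  shows "(\<Sum>u\<in>X. adjacency E u v) = 0 \<longleftrightarrow> even (card {u \<in> X. (u, v) \<in> E})"
  using assms
proof (induction X)
  case (insert x X)
  have "{u \<in> insert x X. (u, v) \<in> E} =
    (if (x, v) \<in> E then insert x {u \<in> X. (u, v) \<in> E} else {u \<in> X. (u, v) \<in> E})" by auto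
  then show ?case using insert by (cases "\<Sum>u\<in>X. adjacency E u v") (auto simp: adjacency_def)
qed simp

text \<open>Dropping the diagonal of \<open>H + M\<close> is harmless: on \<open>D \<union> D'\<close> it may exchange \<open>PauliX\<close> and \<open>PauliY\<close>,
  but the support does not change.\<close>

lemma generator_support_perturbation:
  assumes E: "\<And>u v. u \<in> V \<Longrightarrow> v \<in> V \<Longrightarrow> u \<noteq> v \<Longrightarrow> adjacency E u v = adjacency H u v + M u v"
    and fin: "finite V" and D: "D \<subseteq> V" "D' \<subseteq> V" "D \<inter> D' = {}"
    and M: "\<And>v. v \<in> V \<Longrightarrow> (\<Sum>u\<in>D. M u v) = (\<Sum>u\<in>D'. M u v)"
  shows "generator_support V E (D \<union> D') \<subseteq> generator_support V H D \<union> generator_support V H D'"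
proof
  fix v assume "v \<in> generator_support V E (D \<union> D')"
  then have v: "v \<in> V" "v \<in> D \<union> D' \<or> odd (card {u \<in> D \<union> D'. (u, v) \<in> E})"
    by (auto simp: generator_support_def)
  show "v \<in> generator_support V H D \<union> generator_support V H D'"
  proof (cases "v \<in> D \<union> D'")
    case True
    then show ?thesis using v by (auto simp: generator_support_def)
  next
    case False
    have fD: "finite D" "finite D'" using D fin finite_subset by blast+
    \<comment> \<open>As \<open>v\<close> lies outside both sets, only off-diagonal entries occur,
      and for them the perturbation is plain addition.\<close>
    have "(\<Sum>u\<in>D \<union> D'. adjacency E u v) = (\<Sum>u\<in>D \<union> D'. adjacency H u v + M u v)"
      using False D v(1) by (intro sum.cong refl E) auto
    also have "\<dots> = (\<Sum>u\<in>D. adjacency H u v) + (\<Sum>u\<in>D'. adjacency H u v) +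
        ((\<Sum>u\<in>D. M u v) + (\<Sum>u\<in>D'. M u v))"
      using fD D(3) by (simp add: sum.union_disjoint sum.distrib algebra_simps del: add_bit_eq_xor)
    \<comment> \<open>Equal sums cancel in characteristic 2.\<close>
    also have "(\<Sum>u\<in>D. M u v) + (\<Sum>u\<in>D'. M u v) = 0" using M[OF v(1)] by simp
    finally have "(\<Sum>u\<in>D. adjacency H u v) \<noteq> 0 \<or> (\<Sum>u\<in>D'. adjacency H u v) \<noteq> 0"
      using v(2) False sum_adjacency_eq_0_iff[of "D \<union> D'" E v] fD by auto
    then show ?thesis using v(1) fD by (auto simp: sum_adjacency_eq_0_iff generator_support_def)
  qed
qed

text \<open>The \<open>q * m\<close> sets are split into \<open>m\<close> batches of
  \<open>q\<close> consecutive ones. Each batch exceeds the number of possible row sums, so it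
  contains a pair on which the perturbation cancels; the union of this pair is kept.\<close>

lemma perturbed_generator_packing:
  fixes D :: "nat \<Rightarrow> 'v set"
  assumes pert: "rank_perturbation p V H E" and q: "2 ^ p < q"
    and D: "\<And>i. i < q * m \<Longrightarrow> D i \<subseteq> V \<and> D i \<noteq> {} \<and> card (generator_support V H (D i)) \<le> L"
    and disj: "\<And>i j. i < q * m \<Longrightarrow> j < q * m \<Longrightarrow> i \<noteq> j \<Longrightarrow>
      generator_support V H (D i) \<inter> generator_support V H (D j) = {}"
  shows "\<exists>D'::nat \<Rightarrow> 'v set.
    (\<forall>g<m. D' g \<subseteq> V \<and> D' g \<noteq> {} \<and> card (generator_support V E (D' g)) \<le> 2 * L) \<and>
    (\<forall>g<m. \<forall>h<m. g \<noteq> h \<longrightarrow> generator_support V E (D' g) \<inter> generator_support V E (D' h) = {})"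
proof -
  obtain M where fin: "finite V" and M: "bit_rank V M \<le> p"
    "\<And>u v. u \<in> V \<Longrightarrow> v \<in> V \<Longrightarrow> u \<noteq> v \<Longrightarrow> adjacency E u v = adjacency H u v + M u v"
    using pert by (auto simp: rank_perturbation_def simple_graph_def)
  have lt: "i < q * m" if "g < m" "i \<in> {g * q..<g * q + q}" for g i
  proof -
    have "i < Suc g * q" using that by simp
    also have "\<dots> \<le> m * q" using that by (intro mult_le_mono1) simp
    finally show ?thesis by (simp add: mult.commute)
  qed
  have "\<exists>i j. i \<in> {g * q..<g * q + q} \<and> j \<in> {g * q..<g * q + q} \<and> i \<noteq> j \<and>
      (\<forall>v\<in>V. (\<Sum>u\<in>D i. M u v) = (\<Sum>u\<in>D j. M u v))" if "g < m" for g
  proof -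
    have "\<exists>i\<in>{g * q..<g * q + q}. \<exists>j\<in>{g * q..<g * q + q}. i \<noteq> j \<and>
        (\<forall>v\<in>V. (\<Sum>u\<in>D i. M u v) = (\<Sum>u\<in>D j. M u v))"
      by (rule equal_row_sums[OF fin M(1)]) (use q D[THEN conjunct1] lt[OF that] in simp_all)
    then show ?thesis by blast
  qed
  then obtain i j where ij: "\<And>g. g < m \<Longrightarrow> i g \<in> {g * q..<g * q + q}"
    "\<And>g. g < m \<Longrightarrow> j g \<in> {g * q..<g * q + q}" "\<And>g. g < m \<Longrightarrow> i g \<noteq> j g"
    "\<And>g v. g < m \<Longrightarrow> v \<in> V \<Longrightarrow> (\<Sum>u\<in>D (i g). M u v) = (\<Sum>u\<in>D (j g). M u v)"
    by metis
  let ?S = "generator_support V H"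
  have sub: "generator_support V E (D (i g) \<union> D (j g)) \<subseteq> ?S (D (i g)) \<union> ?S (D (j g))" if g: "g < m" for g
  proof (rule generator_support_perturbation[OF M(2) fin])
    show "D (i g) \<subseteq> V" "D (j g) \<subseteq> V" using D lt[OF g] ij g by auto
    then have "D (i g) \<subseteq> ?S (D (i g))" "D (j g) \<subseteq> ?S (D (j g))" by (auto simp: generator_support_def)
    then show "D (i g) \<inter> D (j g) = {}"
      using disj[OF lt[OF g ij(1)[OF g]] lt[OF g ij(2)[OF g]] ij(3)[OF g]] by blast
    show "(\<Sum>u\<in>D (i g). M u v) = (\<Sum>u\<in>D (j g). M u v)" if "v \<in> V" for v using ij(4)[OF g that] .
  qed
  show ?thesis
  proof (intro exI[of _ "\<lambda>g. D (i g) \<union> D (j g)"] conjI allI impI)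
    fix g assume g: "g < m"
    show "D (i g) \<union> D (j g) \<subseteq> V" "D (i g) \<union> D (j g) \<noteq> {}" using D lt[OF g] ij(1,2)[OF g] by auto
    have "finite (?S X)" for X using fin by (simp add: generator_support_def)
    then have "card (generator_support V E (D (i g) \<union> D (j g))) \<le> card (?S (D (i g)) \<union> ?S (D (j g)))"
      by (intro card_mono sub[OF g]) auto
    also have "\<dots> \<le> card (?S (D (i g))) + card (?S (D (j g)))" by (rule card_Un_le)
    also have "\<dots> \<le> 2 * L"
      using D[OF lt[OF g ij(1)[OF g]]] D[OF lt[OF g ij(2)[OF g]]] by simp
    finally show "card (generator_support V E (D (i g) \<union> D (j g))) \<le> 2 * L" .
    fix h assume h: "h < m" "g \<noteq> h"
    \<comment> \<open>Division by \<open>q\<close> recovers the batch from the index, so different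
      batches use different sets.\<close>
    have *: "k \<noteq> l" if "k \<in> {g * q..<g * q + q}" "l \<in> {h * q..<h * q + q}" for k l
    proof -
      have "k div q = g" "l div q = h"
        using that by (auto intro!: div_nat_eqI simp: mult.commute)
      then show ?thesis using h(2) by auto
    qed
    have "?S (D k) \<inter> ?S (D l) = {}" if "k \<in> {i g, j g}" "l \<in> {i h, j h}" for k l
    proof (rule disj)
      show "k < q * m" "l < q * m" using that ij(1,2)[OF g] ij(1,2)[OF h(1)] lt[OF g] lt[OF h(1)] by auto
      show "k \<noteq> l" using that ij(1,2)[OF g] ij(1,2)[OF h(1)] by (intro *) auto
    qed
    then have "(?S (D (i g)) \<union> ?S (D (j g))) \<inter> (?S (D (i h)) \<union> ?S (D (j h))) = {}"
      by (simp add: Int_Un_distrib Int_Un_distrib2)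
    then show "generator_support V E (D (i g) \<union> D (j g)) \<inter> generator_support V E (D (i h) \<union> D (j h)) = {}"
      using sub[OF g] sub[OF h(1)] by blast
  qed
qed

section \<open>Chord diagrams as double occurrence words\<close>

text \<open>Twice the signed area of the triangle \<open>p\<close>, \<open>q\<close>,
  \<open>z\<close>: it vanishes on the line through \<open>p\<close> and \<open>q\<close>, and its
  sign tells the side of \<open>z\<close>.\<close>

definition chord_side :: "complex \<Rightarrow> complex \<Rightarrow> complex \<Rightarrow> real" where
  "chord_side p q z = Im ((z - p) * cnj (q - p))"

lemma chord_side_convex_combination:
  "chord_side p q ((1 - t) *\<^sub>R x + t *\<^sub>R y) = (1 - t) * chord_side p q x + t * chord_side p q y"
  by (simp add: chord_side_def algebra_simps)

text \<open>In factored form the side can be read off from the order of the three angles by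
  \<open>sin_half_sign\<close>.\<close>

lemma chord_side_cis:
  "chord_side (cis \<alpha>) (cis \<beta>) (cis \<theta>) =
    4 * sin ((\<beta> - \<alpha>) / 2) * sin ((\<theta> - \<alpha>) / 2) * sin ((\<theta> - \<beta>) / 2)"
proof -
  define A B where "A = (\<theta> - \<alpha>) / 2" and "B = (\<theta> - \<beta>) / 2"
  have e: "\<alpha> = \<theta> - 2 * A" "\<beta> = \<theta> - 2 * B" "(\<beta> - \<alpha>) / 2 = A - B"
    by (simp_all add: A_def B_def field_simps)
  have "chord_side (cis \<alpha>) (cis \<beta>) (cis \<theta>) = sin (\<theta> - \<beta>) - sin (\<theta> - \<alpha>) + sin (\<beta> - \<alpha>)"
    by (simp add: chord_side_def sin_diff algebra_simps)
  also have "\<dots> = sin (2 * B) - sin (2 * A) + sin (2 * (A - B))" by (simp add: e algebra_simps)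
  also have "\<dots> = 4 * sin (A - B) * sin A * sin B"
  proof -
    have 1: "(cos A)\<^sup>2 = 1 - (sin A)\<^sup>2" "(cos B)\<^sup>2 = 1 - (sin B)\<^sup>2" by (simp_all add: cos_squared_eq)
    have "sin (2 * B) - sin (2 * A) + sin (2 * (A - B)) =
       2 * sin B * cos B - 2 * sin A * cos A + 2 * (sin A * cos B - cos A * sin B) * (cos A * cos B + sin A * sin B)"
      by (simp only: sin_double sin_diff cos_diff)
    also have "\<dots> = 2 * sin B * cos B - 2 * sin A * cos A + 2 * (sin A * cos A * ((cos B)\<^sup>2 - (sin B)\<^sup>2)
        + sin B * cos B * ((sin A)\<^sup>2 - (cos A)\<^sup>2))"
      by (simp add: power2_eq_square algebra_simps)
    also have "\<dots> = 4 * (sin A * cos B - cos A * sin B) * sin A * sin B"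
      unfolding 1 by (simp add: power2_eq_square algebra_simps)
    finally show ?thesis by (simp add: sin_diff)
  qed
  finally show ?thesis by (simp only: e(3) A_def[symmetric] B_def[symmetric])
qed

text \<open>Half the difference lies strictly between \<open>-pi\<close> and \<open>pi\<close>,
  where the sine has the sign of its argument.\<close>

lemma sin_half_sign:
  assumes "-pi < x" "x \<le> pi" "-pi < y" "y \<le> pi"
  shows "0 < sin ((y - x) / 2) \<longleftrightarrow> x < y" "sin ((y - x) / 2) < 0 \<longleftrightarrow> y < x"
proof -
  have "0 < sin ((v - u) / 2)" if "-pi < u" "u < v" "v \<le> pi" for u v
    using that by (intro sin_gt_zero) auto
  from this[of x y] this[of y x] have
    "x < y \<Longrightarrow> 0 < sin ((y - x) / 2)" "y < x \<Longrightarrow> 0 < sin (- ((y - x) / 2))"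
    using assms by (simp_all add: minus_divide_left)
  then show "0 < sin ((y - x) / 2) \<longleftrightarrow> x < y" "sin ((y - x) / 2) < 0 \<longleftrightarrow> y < x"
    by (cases x y rule: linorder_cases; simp; fastforce)+
qed

lemma chord_side_eq_0_in_disc:
  assumes pq: "cmod p = 1" "cmod q = 1" "p \<noteq> q" and w: "chord_side p q w = 0" "cmod w \<le> 1"
  shows "w \<in> closed_segment p q"
proof -
  \<comment> \<open>The coordinate of \<open>w\<close> along the line, with \<open>p\<close> at 0
    and \<open>q\<close> at 1.\<close>
  define \<tau> where "\<tau> = Re ((w - p) * cnj (q - p)) / (cmod (q - p))\<^sup>2"
  have "(w - p) * cnj (q - p) = of_real (Re ((w - p) * cnj (q - p)))"
    using w(1) by (simp add: chord_side_def complex_eq_iff)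
  then have "(w - p) * (cnj (q - p) * (q - p)) = of_real (Re ((w - p) * cnj (q - p))) * (q - p)"
    by (metis mult.assoc)
  then have "(w - p) * of_real ((cmod (q - p))\<^sup>2) = of_real (Re ((w - p) * cnj (q - p))) * (q - p)"
    by (simp only: complex_norm_square mult.commute)
  then have "w - p = \<tau> *\<^sub>R (q - p)"
    using pq(3) by (simp add: \<tau>_def scaleR_conv_of_real field_simps)
  then have w_eq: "w = (1 - \<tau>) *\<^sub>R p + \<tau> *\<^sub>R q" by (simp add: algebra_simps)
  \<comment> \<open>\<open>|(1 - \<tau>) p + \<tau> q|\<^sup>2 = 1 - \<tau> (1 - \<tau>) |p - q|\<^sup>2\<close>, so \<open>|w| \<le> 1\<close> forces \<open>0 \<le> \<tau> \<le> 1\<close>\<close>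
  obtain a b c d where ab: "p = Complex a b" "q = Complex c d" by (metis complex.exhaust)
  have n: "a\<^sup>2 + b\<^sup>2 = 1" "c\<^sup>2 + d\<^sup>2 = 1" using pq by (auto simp: ab complex_norm)
  have "((1 - \<tau>) * a + \<tau> * c)\<^sup>2 + ((1 - \<tau>) * b + \<tau> * d)\<^sup>2 \<le> 1"
    using w(2) unfolding w_eq ab by (simp add: cmod_def)
  moreover have "((1 - \<tau>) * a + \<tau> * c)\<^sup>2 + ((1 - \<tau>) * b + \<tau> * d)\<^sup>2 =
      (1 - \<tau>) * (a\<^sup>2 + b\<^sup>2) + \<tau> * (c\<^sup>2 + d\<^sup>2) - \<tau> * (1 - \<tau>) * ((a - c)\<^sup>2 + (b - d)\<^sup>2)"
    by (simp add: power2_eq_square algebra_simps)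
  ultimately have "0 \<le> \<tau> * (1 - \<tau>) * ((a - c)\<^sup>2 + (b - d)\<^sup>2)" by (simp add: n)
  moreover have "0 < (a - c)\<^sup>2 + (b - d)\<^sup>2" using pq(3) by (simp add: ab sum_power2_gt_zero_iff)
  ultimately have "0 \<le> \<tau> * (1 - \<tau>)" by (simp add: zero_le_mult_iff)
  then have "0 \<le> \<tau>" "\<tau> \<le> 1" by (auto simp: zero_le_mult_iff)
  then show ?thesis using w_eq by (auto simp: in_segment)
qed

text \<open>The ends of the second chord lie on opposite sides of the first, so it crosses the line
  of the first; the crossing point is in the disc and hence on the first chord.\<close>

lemma interlaced_chords_intersect:
  assumes ord: "-pi < \<alpha>" "\<alpha> < \<gamma>" "\<gamma> < \<beta>" "\<beta> < \<delta>" "\<delta> \<le> pi"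
  shows "closed_segment (cis \<alpha>) (cis \<beta>) \<inter> closed_segment (cis \<gamma>) (cis \<delta>) \<noteq> {}"
proof -
  let ?s = "\<lambda>\<theta>. chord_side (cis \<alpha>) (cis \<beta>) (cis \<theta>)"
  have pos: "0 < sin ((v - u) / 2)" if "-pi < u" "u < v" "v \<le> pi" for u v
    using that sin_half_sign(1)[of u v] by simp
  have neg: "sin ((v - u) / 2) < 0" if "-pi < v" "v < u" "u \<le> pi" for u v
    using that sin_half_sign(2)[of u v] by simp
  have s: "?s \<gamma> < 0" "0 < ?s \<delta>"
    unfolding chord_side_cis using ord by (simp_all add: mult_pos_neg pos neg)
  have ne: "cis \<alpha> \<noteq> cis \<beta>"
  proof
    assume "cis \<alpha> = cis \<beta>"
    then have "?s \<delta> = 0" by (simp add: chord_side_def)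
    then show False using s by simp
  qed
  have "\<exists>t::real. 0 \<le> t \<and> t \<le> 1 \<and> (1 - t) * x + t * y = 0" if "x < 0" "0 < y" for x y
    \<comment> \<open>The zero of the linear interpolation from \<open>x\<close> to
      \<open>y\<close>.\<close>
    by (rule exI[of _ "x / (x - y)"]) (use that in \<open>auto simp: field_simps\<close>)
  from this[OF s] obtain t where t: "0 \<le> t" "t \<le> 1" "(1 - t) * ?s \<gamma> + t * ?s \<delta> = 0"
    by blast
  define w where "w = (1 - t) *\<^sub>R cis \<gamma> + t *\<^sub>R cis \<delta>"
  have "chord_side (cis \<alpha>) (cis \<beta>) w = (1 - t) * ?s \<gamma> + t * ?s \<delta>"
    unfolding w_def by (rule chord_side_convex_combination)
  also note t(3)
  finally have "chord_side (cis \<alpha>) (cis \<beta>) w = 0" .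
  moreover have w_seg: "w \<in> closed_segment (cis \<gamma>) (cis \<delta>)" unfolding w_def in_segment using t(1,2) by blast
  moreover have "closed_segment (cis \<gamma>) (cis \<delta>) \<subseteq> cball 0 1"
    by (intro closed_segment_subset) auto
  ultimately have "w \<in> closed_segment (cis \<alpha>) (cis \<beta>)"
    by (intro chord_side_eq_0_in_disc) (use ne in auto)
  then show ?thesis using w_seg by blast
qed

text \<open>\<open>chord_side p q\<close> is affine: it keeps a strict sign between \<open>x\<close>
  and \<open>y\<close>, but vanishes between \<open>p\<close> and \<open>q\<close>.\<close>

lemma chords_disjoint_if_same_side:
  assumes "0 < chord_side p q x * chord_side p q y"
  shows "closed_segment p q \<inter> closed_segment x y = {}"
proof (rule ccontr)
  assume "\<not> ?thesis"
  then obtain z where "z \<in> closed_segment x y" "z \<in> closed_segment p q" by blast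
  then obtain t u where tu: "0 \<le> t" "t \<le> 1"
      "(1 - t) *\<^sub>R x + t *\<^sub>R y = (1 - u) *\<^sub>R p + u *\<^sub>R q"
    unfolding in_segment by metis
  have "chord_side p q p = 0" "chord_side p q q = 0" by (simp_all add: chord_side_def algebra_simps)
  then have "(1 - t) * chord_side p q x + t * chord_side p q y = 0"
    using chord_side_convex_combination[of p q t x y] chord_side_convex_combination[of p q u p q] tu(3) by simp
  moreover have "(1 - t) * a + t * b > 0" if "0 < a" "0 < b" for a b :: real
    using that tu by (cases "t = 0") (auto intro!: add_nonneg_pos)
  from this[of "chord_side p q x" "chord_side p q y"] this[of "- chord_side p q x" "- chord_side p q y"]
  have "(1 - t) * chord_side p q x + t * chord_side p q y \<noteq> 0"
    using assms by (auto simp: zero_less_mult_iff)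
  ultimately show False by simp
qed

text \<open>Weak inequalities are required, since chords with a common end intersect. Otherwise the
  chords are separated or nested, and both ends of one lie strictly on one side of the
  other.\<close>

lemma chords_intersect_iff:
  assumes ord: "-pi < \<alpha>" "\<alpha> < \<beta>" "\<beta> \<le> pi" "-pi < \<gamma>" "\<gamma> < \<delta>" "\<delta> \<le> pi"
  shows "closed_segment (cis \<alpha>) (cis \<beta>) \<inter> closed_segment (cis \<gamma>) (cis \<delta>) \<noteq> {} \<longleftrightarrow>
    (\<alpha> \<le> \<gamma> \<and> \<gamma> \<le> \<beta> \<and> \<beta> \<le> \<delta>) \<or> (\<gamma> \<le> \<alpha> \<and> \<alpha> \<le> \<delta> \<and> \<delta> \<le> \<beta>)"
    (is "?I \<longleftrightarrow> ?R")
proof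
  assume ?R
  then consider "\<alpha> = \<gamma>" | "\<alpha> = \<delta>" | "\<beta> = \<gamma>" | "\<beta> = \<delta>"
    | "\<alpha> < \<gamma>" "\<gamma> < \<beta>" "\<beta> < \<delta>" | "\<gamma> < \<alpha>" "\<alpha> < \<delta>" "\<delta> < \<beta>"
    by linarith
  then show ?I
  proof cases
    case 5
    then show ?thesis using ord by (intro interlaced_chords_intersect) auto
  next
    case 6
    then show ?thesis using ord interlaced_chords_intersect[of \<gamma> \<alpha> \<delta> \<beta>] by (simp add: Int_commute)
  qed (metis ends_in_segment disjoint_iff)+
next
  assume I: ?I
  show ?R
  proof (rule ccontr)
    assume "\<not> ?R"
    then consider "\<beta> < \<gamma>" | "\<delta> < \<alpha>" | "\<alpha> < \<gamma>" "\<delta> < \<beta>" | "\<gamma> < \<alpha>" "\<beta> < \<delta>"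
      using ord by linarith
    note cs = this
    have pos: "0 < sin ((v - u) / 2)" if "-pi < u" "u < v" "v \<le> pi" for u v
      using that sin_half_sign(1)[of u v] by simp
    have neg: "sin ((v - u) / 2) < 0" if "-pi < v" "v < u" "u \<le> pi" for u v
      using that sin_half_sign(2)[of u v] by simp
    have "0 < sin ((\<beta> - \<alpha>) / 2)" using pos ord by auto
    \<comment> \<open>Up to the factor \<open>16 * (sin ((\<beta> - \<alpha>) / 2))\<^sup>2\<close>,
      this is the product of the sides of the two ends.\<close>
    moreover have "0 < (sin ((\<gamma> - \<alpha>) / 2) * sin ((\<gamma> - \<beta>) / 2)) * (sin ((\<delta> - \<alpha>) / 2) * sin ((\<delta> - \<beta>) / 2))"
      using cs
    proof cases
      case 1
      then show ?thesis using ord by (intro mult_pos_pos pos) auto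
    next
      case 2
      then show ?thesis using ord by (intro mult_pos_pos mult_neg_neg[of "sin _" "sin _"] neg) auto
    next
      case 3
      then show ?thesis using ord
        by (intro mult_neg_neg[of "sin _ * sin _" "sin _ * sin _"] mult_pos_neg[of "sin _" "sin _"] pos neg) auto
    next
      case 4
      then show ?thesis using ord
        by (intro mult_pos_pos[of "sin _ * sin _" "sin _ * sin _"] mult_neg_neg[of "sin ((\<gamma> - _) / 2)"]
          mult_pos_pos[of "sin ((\<delta> - _) / 2)"] pos neg) auto
    qed
    ultimately have "0 < 16 * (sin ((\<beta> - \<alpha>) / 2))\<^sup>2 *
        ((sin ((\<gamma> - \<alpha>) / 2) * sin ((\<gamma> - \<beta>) / 2)) * (sin ((\<delta> - \<alpha>) / 2) * sin ((\<delta> - \<beta>) / 2)))"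
      by simp
    then have "0 < chord_side (cis \<alpha>) (cis \<beta>) (cis \<gamma>) * chord_side (cis \<alpha>) (cis \<beta>) (cis \<delta>)"
      by (simp only: chord_side_cis power2_eq_square mult_ac)
    then show False using chords_disjoint_if_same_side I by blast
  qed
qed

text \<open>The circle is cut at angle \<open>pi\<close>, the chord ends are sorted by angle, and
  their ranks become the positions of the word.\<close>

lemma circle_graph_word:
  fixes V :: "nat set"
  assumes "circle_graph V H"
  shows "\<exists>a b. double_occurrence_word V H a b"
proof -
  obtain p q :: "nat \<Rightarrow> complex" where fin: "finite V"
    and pq: "\<And>v. v \<in> V \<Longrightarrow> p v \<in> sphere 0 1 \<and> q v \<in> sphere 0 1 \<and> p v \<noteq> q v"
    and H: "\<And>u v. u \<in> V \<Longrightarrow> v \<in> V \<Longrightarrow> u \<noteq> v \<Longrightarrow>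
      (u, v) \<in> H \<longleftrightarrow> closed_segment (p u) (q u) \<inter> closed_segment (p v) (q v) \<noteq> {}"
    using assms unfolding circle_graph_def simple_graph_def by metis
  define lo hi where "lo v = min (Arg (p v)) (Arg (q v))" and "hi v = max (Arg (p v)) (Arg (q v))" for v
  have lohi: "-pi < lo v" "lo v < hi v" "hi v \<le> pi"
    "closed_segment (p v) (q v) = closed_segment (cis (lo v)) (cis (hi v))" if "v \<in> V" for v
  proof -
    have c: "cis (Arg (p v)) = p v" "cis (Arg (q v)) = q v"
      using pq[OF that] by (subst cis_Arg; force simp: sgn_div_norm)+
    then have "Arg (p v) \<noteq> Arg (q v)" using pq[OF that] by metis
    then show "-pi < lo v" "lo v < hi v" "hi v \<le> pi"
      using Arg_bounded[of "p v"] Arg_bounded[of "q v"] by (auto simp: lo_def hi_def)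
    show "closed_segment (p v) (q v) = closed_segment (cis (lo v)) (cis (hi v))"
      by (cases "Arg (p v) \<le> Arg (q v)") (auto simp: lo_def hi_def c closed_segment_commute)
  qed
  have H: "(u, v) \<in> H \<longleftrightarrow>
      (lo u \<le> lo v \<and> lo v \<le> hi u \<and> hi u \<le> hi v) \<or> (lo v \<le> lo u \<and> lo u \<le> hi v \<and> hi v \<le> hi u)"
    if "u \<in> V" "v \<in> V" "u \<noteq> v" for u v
    using H[OF that] lohi[OF that(1)] lohi[OF that(2)] chords_intersect_iff[of "lo u" "hi u" "lo v" "hi v"] by simp
  \<comment> \<open>Chords with a common endpoint intersect, so ties have to be broken such that they become
    interlaced: at a common point first ends precede last ends, and ends of the same kind are ordered
    like the other ends of their chords; equal chords are ordered by their labels.\<close>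
  define first_key last_key where "first_key v = [lo v, 0, hi v, real v]"
    and "last_key v = [hi v, 1, lo v, real v]" for v
  define K where "K = first_key ` V \<union> last_key ` V"
  \<comment> \<open>Ranks compress the sorted keys to the positions \<open>0\<close> to
    \<open>2 * card V - 1\<close>.\<close>
  define rank where "rank k = card {k' \<in> K. k' < k}" for k
  have finK: "finite K" using fin by (simp add: K_def)
  have inj: "inj first_key" "inj last_key" "first_key u \<noteq> last_key v" for u v
    by (auto simp: inj_def first_key_def last_key_def)
  have cK: "card K = 2 * card V"
  proof -
    have "card K = card (first_key ` V) + card (last_key ` V)"
      unfolding K_def using fin inj(3) by (intro card_Un_disjoint) auto
    then show ?thesis using inj(1,2) by (simp add: card_image inj_on_subset[OF _ subset_UNIV])
  qed
  have rank_less: "rank k < rank l" if "k \<in> K" "k < l" for k l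
    unfolding rank_def using that finK by (intro psubset_card_mono) auto
  have rank_iff: "rank k < rank l \<longleftrightarrow> k < l" if "k \<in> K" "l \<in> K" for k l
    using rank_less[of k l] rank_less[of l k] that by (cases k l rule: linorder_cases) auto
  have rank_bound: "rank k < 2 * card V" if "k \<in> K" for k
    unfolding rank_def cK[symmetric] using that finK by (intro psubset_card_mono) auto
  have rank_inj: "inj_on rank K"
  proof (rule inj_onI)
    fix k l assume "k \<in> K" "l \<in> K" "rank k = rank l"
    then show "k = l" using rank_iff[of k l] rank_iff[of l k] by (metis less_irrefl linorder_neqE)
  qed
  have K: "first_key v \<in> K" "last_key v \<in> K" if "v \<in> V" for v using that by (auto simp: K_def)
  have "double_occurrence_word V H (rank \<circ> first_key) (rank \<circ> last_key)"
    unfolding double_occurrence_word_def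
  proof (intro conjI ballI impI)
    show "inj_on (rank \<circ> first_key) V" "inj_on (rank \<circ> last_key) V"
      using rank_inj inj K by (auto simp: inj_on_def)
    show "(rank \<circ> first_key) ` V \<inter> (rank \<circ> last_key) ` V = {}"
      using rank_inj inj(3) K by (fastforce simp: inj_on_def)
    show "(rank \<circ> first_key) v < (rank \<circ> last_key) v" "(rank \<circ> last_key) v < 2 * card V" if "v \<in> V" for v
      using lohi(2)[OF that] rank_bound[OF K(2)[OF that]]
      by (simp_all add: rank_iff K that) (simp add: first_key_def last_key_def)
    fix u v assume uv: "u \<in> V" "v \<in> V" "u \<noteq> v"
    have "(u, v) \<in> H \<longleftrightarrow> (first_key u < first_key v \<and> first_key v < last_key u \<and> last_key u < last_key v) \<or>
        (first_key v < first_key u \<and> first_key u < last_key v \<and> last_key v < last_key u)"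
      unfolding H[OF uv] using uv(3) by (auto simp: first_key_def last_key_def)
    then show "(u, v) \<in> H \<longleftrightarrow>
        ((rank \<circ> first_key) u < (rank \<circ> first_key) v \<and> (rank \<circ> first_key) v < (rank \<circ> last_key) u \<and>
          (rank \<circ> last_key) u < (rank \<circ> last_key) v) \<or>
        ((rank \<circ> first_key) v < (rank \<circ> first_key) u \<and> (rank \<circ> first_key) u < (rank \<circ> last_key) v \<and>
          (rank \<circ> last_key) v < (rank \<circ> last_key) u)"
      by (simp add: rank_iff K uv)
  qed
  then show ?thesis by blast
qed

section \<open>Stabilizers of graph states and local equivalence\<close>

lemma sum_Pow_prod_bool:
  fixes h :: "'v \<Rightarrow> bool \<Rightarrow> 'a::comm_semiring_1"
  assumes "finite V"
  shows "(\<Sum>B\<in>Pow V. \<Prod>v\<in>V. h v (v \<in> B)) = (\<Prod>v\<in>V. \<Sum>b\<in>UNIV. h v b)"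
proof -
  have "(\<Prod>v\<in>V. h v (v \<in> B)) = (\<Prod>v\<in>B. h v True) * (\<Prod>v\<in>V - B. h v False)" if "B \<in> Pow V" for B
    using prod.subset_diff[of B V "\<lambda>v. h v (v \<in> B)"] that assms by (simp add: mult.commute)
  then show ?thesis
    by (simp add: UNIV_bool prod_add[OF assms] add.commute[of "h _ False"])
qed

lemma tensor_op_cong:
  "(\<And>v. v \<in> V \<Longrightarrow> M v = N v) \<Longrightarrow> tensor_op V M \<psi> = tensor_op V N \<psi>"
  by (auto simp: tensor_op_def fun_eq_iff intro!: sum.cong prod.cong arg_cong2[of _ _ _ _ "(*)"])

lemma tensor_op_scale: "tensor_op V M (\<lambda>A. c * \<psi> A) = (\<lambda>A. c * tensor_op V M \<psi> A)"
  by (auto simp: tensor_op_def fun_eq_iff sum_distrib_left mult_ac)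

text \<open>The sum over intermediate basis vectors factors over the qubits, leaving one matrix
  product for each.\<close>

lemma tensor_op_tensor_op:
  assumes "finite V"
  shows "tensor_op V M (tensor_op V N \<psi>) = tensor_op V (\<lambda>v. M v ** N v) \<psi>"
proof
  fix A
  show "tensor_op V M (tensor_op V N \<psi>) A = tensor_op V (\<lambda>v. M v ** N v) \<psi> A"
  proof (cases "A \<subseteq> V")
    case True
    let ?m = "\<lambda>B. \<Prod>v\<in>V. M v $ (v \<in> A) $ (v \<in> B)" and ?n = "\<lambda>B C. \<Prod>v\<in>V. N v $ (v \<in> B) $ (v \<in> C)"
    have "tensor_op V M (tensor_op V N \<psi>) A = (\<Sum>B\<in>Pow V. ?m B * (\<Sum>C\<in>Pow V. ?n B C * \<psi> C))"
      using True by (simp add: tensor_op_def)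
    also have "\<dots> = (\<Sum>B\<in>Pow V. \<Sum>C\<in>Pow V. ?m B * ?n B C * \<psi> C)"
      by (simp add: sum_distrib_left mult.assoc)
    also have "\<dots> = (\<Sum>C\<in>Pow V. \<Sum>B\<in>Pow V. ?m B * ?n B C * \<psi> C)" by (rule sum.swap)
    also have "\<dots> = (\<Sum>C\<in>Pow V. (\<Sum>B\<in>Pow V. ?m B * ?n B C) * \<psi> C)"
      by (simp add: sum_distrib_right)
    also have "\<dots> = (\<Sum>C\<in>Pow V. (\<Prod>v\<in>V. (M v ** N v) $ (v \<in> A) $ (v \<in> C)) * \<psi> C)"
    proof (rule sum.cong[OF refl])
      fix C
      have "(\<Sum>B\<in>Pow V. ?m B * ?n B C) =
          (\<Sum>B\<in>Pow V. \<Prod>v\<in>V. M v $ (v \<in> A) $ (v \<in> B) * N v $ (v \<in> B) $ (v \<in> C))"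
        by (simp add: prod.distrib)
      also have "\<dots> = (\<Prod>v\<in>V. \<Sum>b\<in>UNIV. M v $ (v \<in> A) $ b * N v $ b $ (v \<in> C))"
        by (rule sum_Pow_prod_bool[OF assms])
      finally show "(\<Sum>B\<in>Pow V. ?m B * ?n B C) * \<psi> C = (\<Prod>v\<in>V. (M v ** N v) $ (v \<in> A) $ (v \<in> C)) * \<psi> C"
        by (simp add: matrix_matrix_mult_def)
    qed
    finally show ?thesis using True by (simp add: tensor_op_def)
  qed (simp add: tensor_op_def)
qed

lemma tensor_op_mat_1:
  assumes "finite V" "\<And>A. \<not> A \<subseteq> V \<Longrightarrow> \<psi> A = 0"
  shows "tensor_op V (\<lambda>_. mat 1) \<psi> = \<psi>"
proof
  fix A
  show "tensor_op V (\<lambda>_. mat 1) \<psi> A = \<psi> A"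
  proof (cases "A \<subseteq> V")
    case True
    have "(\<Prod>v\<in>V. (mat 1 :: complex^bool^bool) $ (v \<in> A) $ (v \<in> B)) * \<psi> B = (if B = A then \<psi> B else 0)"
      if "B \<in> Pow V" for B
    proof (cases "B = A")
      case False
      then obtain v where "v \<in> V" "(v \<in> A) \<noteq> (v \<in> B)" using True \<open>B \<in> Pow V\<close> by blast
      then have "(\<Prod>v\<in>V. (mat 1 :: complex^bool^bool) $ (v \<in> A) $ (v \<in> B)) = 0"
        using assms(1) by (intro prod_zero) (auto simp: mat_def)
      then show ?thesis using False by simp
    qed (simp add: mat_def)
    then have "tensor_op V (\<lambda>_. mat 1) \<psi> A = (\<Sum>B\<in>Pow V. if B = A then \<psi> B else 0)"
      using True by (simp add: tensor_op_def)
    then show ?thesis using True assms(1) by (simp add: sum.delta)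
  qed (simp add: tensor_op_def assms(2))
qed

section \<open>Clifford conjugation of Pauli operators\<close>

definition scale_mat :: "complex \<Rightarrow> complex^bool^bool \<Rightarrow> complex^bool^bool" where
  "scale_mat c M = (\<chi> i j. c * M $ i $ j)"

lemma tensor_op_scale_mat:
  "tensor_op V (\<lambda>v. scale_mat (\<eta> v) (M v)) \<psi> = (\<lambda>A. (\<Prod>v\<in>V. \<eta> v) * tensor_op V M \<psi> A)"
  by (auto simp: tensor_op_def scale_mat_def fun_eq_iff prod.distrib sum_distrib_left mult.assoc)

lemma scale_mat_mult: "scale_mat c M ** N = scale_mat c (M ** N)" "M ** scale_mat c N = scale_mat c (M ** N)"
  by (simp_all add: scale_mat_def matrix_matrix_mult_def vec_eq_iff sum_distrib_left mult_ac)

lemma pauli_mats_eq: "pauli_mats = {scale_mat \<omega> (pauli_mat a) | \<omega> a. \<omega> \<in> pauli_phases}"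
  by (simp add: pauli_mats_def scale_mat_def)

lemma pauli_mat_scalar: "pauli_mat a = scale_mat c (mat 1) \<Longrightarrow> a = PauliI"
proof -
  assume "pauli_mat a = scale_mat c (mat 1)"
  then have "pauli_mat a $ i $ j = scale_mat c (mat 1) $ i $ j" for i j by simp
  from this[of False True] this[of False False] this[of True True] show ?thesis
    by (cases a) (simp_all add: scale_mat_def mat_def)
qed

text \<open>Conjugation by \<open>U\<close> maps \<open>pauli_mats\<close> onto itself, so its
  inverse also sends Pauli matrices to Pauli matrices. Scalars are fixed, and only the identity is
  scalar.\<close>

lemma clifford_conjugate_pauli:
  assumes "clifford U"
  shows "\<exists>\<eta> b. \<eta> \<in> pauli_phases \<and> (b = PauliI \<longleftrightarrow> a = PauliI) \<and>
    adjoint_mat U ** pauli_mat a ** U = scale_mat \<eta> (pauli_mat b)"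
proof -
  have U: "U ** adjoint_mat U = mat 1" "adjoint_mat U ** U = mat 1"
    "(\<lambda>Q. U ** Q ** adjoint_mat U) ` pauli_mats = pauli_mats"
    using assms by (auto simp: clifford_def)
  have "pauli_mat a = scale_mat 1 (pauli_mat a)" by (simp add: scale_mat_def)
  then have "pauli_mat a \<in> pauli_mats" unfolding pauli_mats_eq pauli_phases_def by blast
  then obtain Q where Q: "Q \<in> pauli_mats" "pauli_mat a = U ** Q ** adjoint_mat U" using U(3) by blast
  then obtain \<eta> b where eb: "\<eta> \<in> pauli_phases" "Q = scale_mat \<eta> (pauli_mat b)"
    unfolding pauli_mats_eq by blast
  have "adjoint_mat U ** pauli_mat a ** U = (adjoint_mat U ** U) ** Q ** (adjoint_mat U ** U)"
    unfolding Q(2) by (simp only: matrix_mul_assoc)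
  then have conj: "adjoint_mat U ** pauli_mat a ** U = scale_mat \<eta> (pauli_mat b)"
    using U(2) eb(2) by simp
  show ?thesis
  proof (cases "a = PauliI")
    case True
    then have "adjoint_mat U ** pauli_mat a ** U = scale_mat 1 (pauli_mat PauliI)"
      using U(2) by (simp add: scale_mat_def)
    then show ?thesis using True by (intro exI[of _ 1] exI[of _ PauliI]) (simp add: pauli_phases_def)
  next
    case False
    have "b \<noteq> PauliI"
    proof
      assume "b = PauliI"
      then have "pauli_mat a = scale_mat \<eta> (mat 1)"
        using Q(2) eb(2) U(1) by (simp add: scale_mat_mult)
      then show False using False pauli_mat_scalar by blast
    qed
    then show ?thesis using False conj eb(1) by blast
  qed
qed

lemma pauli_phases_mult: "\<omega> \<in> pauli_phases \<Longrightarrow> \<eta> \<in> pauli_phases \<Longrightarrow> \<omega> * \<eta> \<in> pauli_phases"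
  by (auto simp: pauli_phases_def)

lemma pauli_phases_prod: "(\<And>v. v \<in> V \<Longrightarrow> \<eta> v \<in> pauli_phases) \<Longrightarrow> prod \<eta> V \<in> pauli_phases"
  proof (induction V rule: infinite_finite_induct)
  case (insert x F)
  then show ?case by (simp add: pauli_phases_mult)
qed (simp_all add: pauli_phases_def)

text \<open>Stabilizers are pulled back by the adjoint of the local unitary. One letterwise map
  \<open>\<pi>\<close> serves all of them, so supports and the relation of being a restriction
  survive; phases are left unspecified.\<close>

lemma stab_locally_equivalent:
  assumes fin: "finite V" and vanish: "\<And>A. \<not> A \<subseteq> V \<Longrightarrow> \<psi> A = 0" and eq: "locally_equivalent V \<psi> \<phi>"
  shows "\<exists>\<pi>. (\<forall>v a. \<pi> v a = PauliI \<longleftrightarrow> a = PauliI) \<and>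
    (\<forall>s\<in>stab V \<phi>. \<exists>\<omega>. (\<omega>, \<lambda>v. \<pi> v (snd s v)) \<in> stab V \<psi>)"
proof -
  obtain U c where U: "\<And>v. v \<in> V \<Longrightarrow> clifford (U v)" and c: "cmod c = 1"
    and \<phi>: "\<phi> = (\<lambda>A. c * tensor_op V U \<psi> A)"
    using eq unfolding locally_equivalent_def by metis
  \<comment> \<open>\<open>U v\<close> is unconstrained outside \<open>V\<close>; there only the
    identity has to be respected, and \<open>b = a\<close> serves.\<close>
  have "\<exists>\<eta> b. (v \<in> V \<longrightarrow> \<eta> \<in> pauli_phases \<and>
      adjoint_mat (U v) ** pauli_mat a ** U v = scale_mat \<eta> (pauli_mat b)) \<and> (b = PauliI \<longleftrightarrow> a = PauliI)" for v a
    using clifford_conjugate_pauli[OF U, of v a] by (cases "v \<in> V") blast+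
  then obtain \<eta> \<pi> where
    \<eta>: "\<And>v a. v \<in> V \<Longrightarrow> \<eta> v a \<in> pauli_phases"
    and conj: "\<And>v a. v \<in> V \<Longrightarrow> adjoint_mat (U v) ** pauli_mat a ** U v = scale_mat (\<eta> v a) (pauli_mat (\<pi> v a))"
    and \<pi>: "\<And>v a. \<pi> v a = PauliI \<longleftrightarrow> a = PauliI"
    by metis
  let ?Ud = "tensor_op V (\<lambda>v. adjoint_mat (U v))"
  have "\<exists>\<omega>. (\<omega>, \<lambda>v. \<pi> v (snd s v)) \<in> stab V \<psi>" if s: "s \<in> stab V \<phi>" for s
  proof -
    let ?P = "\<lambda>v. \<pi> v (snd s v)"
    have sc: "fst s \<in> pauli_phases" "snd s \<in> pauli_strings V"
      using s by (auto simp: stab_def pauli_group_def)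
    define \<omega> where "\<omega> = fst s * (\<Prod>v\<in>V. \<eta> v (snd s v))"
    have "\<omega> \<in> pauli_phases"
      unfolding \<omega>_def by (intro pauli_phases_mult sc pauli_phases_prod \<eta>)
    moreover have "supp ?P = supp (snd s)" by (simp add: supp_def \<pi>)
    ultimately have carrier: "(\<omega>, ?P) \<in> carrier (pauli_group V)"
      using sc by (simp add: pauli_group_def pauli_strings_def)
    have "(\<lambda>A. fst s * tensor_op V (\<lambda>v. pauli_mat (snd s v)) \<phi> A) = \<phi>"
      using s by (simp add: stab_def pauli_op_def)
    then have "?Ud (\<lambda>A. fst s * tensor_op V (\<lambda>v. pauli_mat (snd s v)) \<phi> A) = ?Ud \<phi>" by simp
    then have "(\<lambda>A. fst s * (c * tensor_op V (\<lambda>v. adjoint_mat (U v) ** pauli_mat (snd s v) ** U v) \<psi> A)) =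
        (\<lambda>A. c * tensor_op V (\<lambda>v. adjoint_mat (U v) ** U v) \<psi> A)"
      unfolding \<phi> by (simp only: tensor_op_scale tensor_op_tensor_op[OF fin] matrix_mul_assoc)
    moreover have "tensor_op V (\<lambda>v. adjoint_mat (U v) ** pauli_mat (snd s v) ** U v) \<psi> =
        tensor_op V (\<lambda>v. scale_mat (\<eta> v (snd s v)) (pauli_mat (?P v))) \<psi>"
      by (intro tensor_op_cong conj)
    moreover have "tensor_op V (\<lambda>v. adjoint_mat (U v) ** U v) \<psi> = tensor_op V (\<lambda>_. mat 1) \<psi>"
      using U by (intro tensor_op_cong) (simp add: clifford_def)
    ultimately have "(\<lambda>A. fst s * (c * ((\<Prod>v\<in>V. \<eta> v (snd s v)) * tensor_op V (\<lambda>v. pauli_mat (?P v)) \<psi> A))) =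
        (\<lambda>A. c * \<psi> A)"
      by (simp add: tensor_op_scale_mat tensor_op_mat_1[OF fin vanish])
    moreover have "c \<noteq> 0" using c by auto
    ultimately have "pauli_op V (\<omega>, ?P) \<psi> = \<psi>"
      unfolding pauli_op_def \<omega>_def fun_eq_iff by (simp add: mult.left_commute[of _ c] mult.assoc)
    then show ?thesis using carrier by (auto simp: stab_def)
  qed
  then show ?thesis using \<pi> by blast
qed

section \<open>Products of graph state generators\<close>

definition xz_pauli :: "bool \<Rightarrow> bool \<Rightarrow> pauli" where
  "xz_pauli x z = (if x then if z then PauliY else PauliX else if z then PauliZ else PauliI)"

definition generator_string :: "'v set \<Rightarrow> 'v rel \<Rightarrow> 'v set \<Rightarrow> 'v \<Rightarrow> pauli" where
  "generator_string V E D =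
     (\<lambda>v. if v \<in> V then xz_pauli (v \<in> D) (odd (card {u \<in> D. (u, v) \<in> E})) else PauliI)"

lemma supp_generator_string: "supp (generator_string V E D) = generator_support V E D"
  by (auto simp: supp_def generator_string_def generator_support_def xz_pauli_def)

text \<open>Multiplication by the generator of \<open>x\<close> flips the X bit at \<open>x\<close>
  and the Z bits at its neighbours, which is the effect of adding \<open>x\<close> to
  \<open>D\<close>.\<close>

lemma generator_string_in_generate:
  assumes E: "simple_graph V E" and D: "D \<subseteq> V"
  shows "\<exists>\<omega>. (\<omega>, generator_string V E D) \<in> generate (pauli_group V) (graph_generator E ` V)"
proof -
  have "finite D" using E D finite_subset by (auto simp: simple_graph_def)
  then show ?thesis using D
  proof (induction D)
    case empty
    have "\<one>\<^bsub>pauli_group V\<^esub> = (1, generator_string V E {})"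
      by (auto simp: pauli_group_def generator_string_def xz_pauli_def)
    then show ?case by (metis generate.one)
  next
    case (insert x D)
    then obtain \<omega> where \<omega>: "(\<omega>, generator_string V E D) \<in> generate (pauli_group V) (graph_generator E ` V)"
      by auto
    have xV: "x \<in> V" using insert.prems by auto
    have "snd (pauli_prod (snd (graph_generator E x) v) (generator_string V E D v)) =
        generator_string V E (insert x D) v" for v
    proof (cases "v \<in> V")
      case True
      have loop: "(x, x) \<notin> E" using E by (auto simp: simple_graph_def irrefl_def)
      have "{u \<in> insert x D. (u, v) \<in> E} =
          (if (x, v) \<in> E then insert x {u \<in> D. (u, v) \<in> E} else {u \<in> D. (u, v) \<in> E})" by auto
      then have "odd (card {u \<in> insert x D. (u, v) \<in> E}) \<longleftrightarrow> (odd (card {u \<in> D. (u, v) \<in> E}) \<noteq> ((x, v) \<in> E))"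
        using insert.hyps by simp
      then show ?thesis
        using True loop insert.hyps(2) by (auto simp: generator_string_def graph_generator_def xz_pauli_def)
    next
      case False
      then have "(x, v) \<notin> E" "v \<noteq> x" using E xV by (auto simp: simple_graph_def)
      then show ?thesis using False by (simp add: generator_string_def graph_generator_def)
    qed
    then obtain \<eta> where "graph_generator E x \<otimes>\<^bsub>pauli_group V\<^esub> (\<omega>, generator_string V E D) =
        (\<eta>, generator_string V E (insert x D))"
      by (simp add: pauli_group_def split_beta)
    moreover have "graph_generator E x \<otimes>\<^bsub>pauli_group V\<^esub> (\<omega>, generator_string V E D)
        \<in> generate (pauli_group V) (graph_generator E ` V)"
      by (intro generate.eng[OF generate.incl \<omega>] imageI xV)
    ultimately show ?case by auto
  qed
qed

text \<open>A vertex lies in at most one of the supports, and each other set contributes an even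
  number of neighbours to it.\<close>

lemma generator_string_Union:
  fixes D :: "nat \<Rightarrow> 'v set"
  assumes fin: "finite V" and D: "\<And>i. i < m \<Longrightarrow> D i \<subseteq> V"
    and disj: "\<And>i j. i < m \<Longrightarrow> j < m \<Longrightarrow> i \<noteq> j \<Longrightarrow>
      generator_support V E (D i) \<inter> generator_support V E (D j) = {}"
    and J: "J \<subseteq> {..<m}"
  shows "i \<in> J \<Longrightarrow> v \<in> generator_support V E (D i) \<Longrightarrow>
      generator_string V E (\<Union>i\<in>J. D i) v = generator_string V E (D i) v"
    and "v \<notin> (\<Union>i\<in>J. generator_support V E (D i)) \<Longrightarrow> generator_string V E (\<Union>i\<in>J. D i) v = PauliI"
proof -
  have finJ: "finite J" using J finite_subset by blast
  have sub: "D i \<subseteq> generator_support V E (D i)" if "i \<in> J" for i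
    using D J that by (auto simp: generator_support_def)
  have finD: "finite (D i)" if "i \<in> J" for i using D J that fin finite_subset by (metis lessThan_iff subsetD)
  have card: "card {u \<in> \<Union>i\<in>J. D i. (u, v) \<in> E} = (\<Sum>i\<in>J. card {u \<in> D i. (u, v) \<in> E})" for v
  proof -
    have "{u \<in> \<Union>i\<in>J. D i. (u, v) \<in> E} = (\<Union>i\<in>J. {u \<in> D i. (u, v) \<in> E})" by auto
    also have "card \<dots> = (\<Sum>i\<in>J. card {u \<in> D i. (u, v) \<in> E})"
    proof (rule card_UN_disjoint[OF finJ])
      have "D i \<inter> D j = {}" if "i \<in> J" "j \<in> J" "i \<noteq> j" for i j
      proof -
        have "i < m" "j < m" using that J by auto
        from disj[OF this that(3)] show ?thesis using sub[OF that(1)] sub[OF that(2)] by blast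
      qed
      then show "\<forall>i\<in>J. \<forall>j\<in>J. i \<noteq> j \<longrightarrow> {u \<in> D i. (u, v) \<in> E} \<inter> {u \<in> D j. (u, v) \<in> E} = {}"
        by blast
    qed (use finD in auto)
    finally show ?thesis .
  qed
  have outside: "v \<notin> D i" "even (card {u \<in> D i. (u, v) \<in> E})"
    if "i \<in> J" "v \<in> V" "v \<notin> generator_support V E (D i)" for i v
    using that by (auto simp: generator_support_def)
  show "generator_string V E (\<Union>i\<in>J. D i) v = generator_string V E (D i) v"
    if i: "i \<in> J" and v: "v \<in> generator_support V E (D i)"
  proof -
    have vV: "v \<in> V" using v by (simp add: generator_support_def)
    have other: "v \<notin> D j" "even (card {u \<in> D j. (u, v) \<in> E})" if "j \<in> J - {i}" for j
    proof -
      have "v \<notin> generator_support V E (D j)" using disj[of i j] that i v J by auto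
      then show "v \<notin> D j" "even (card {u \<in> D j. (u, v) \<in> E})" using outside[of j v] vV that by auto
    qed
    have "card {u \<in> \<Union>i\<in>J. D i. (u, v) \<in> E} =
        card {u \<in> D i. (u, v) \<in> E} + (\<Sum>j\<in>J - {i}. card {u \<in> D j. (u, v) \<in> E})"
      unfolding card by (rule sum.remove[OF finJ i])
    moreover have "even (\<Sum>j\<in>J - {i}. card {u \<in> D j. (u, v) \<in> E})" using other by (intro dvd_sum)
    ultimately have "odd (card {u \<in> \<Union>i\<in>J. D i. (u, v) \<in> E}) \<longleftrightarrow> odd (card {u \<in> D i. (u, v) \<in> E})"
      by simp
    moreover have "v \<in> (\<Union>i\<in>J. D i) \<longleftrightarrow> v \<in> D i" using other(1) i by blast
    ultimately show ?thesis using vV unfolding generator_string_def by presburger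
  qed
  show "generator_string V E (\<Union>i\<in>J. D i) v = PauliI"
    if "v \<notin> (\<Union>i\<in>J. generator_support V E (D i))"
  proof (cases "v \<in> V")
    case True
    have "even (card {u \<in> \<Union>i\<in>J. D i. (u, v) \<in> E})"
      unfolding card using that outside(2) True by (intro dvd_sum) auto
    moreover have "v \<notin> (\<Union>i\<in>J. D i)" using that outside(1) True by blast
    ultimately show ?thesis unfolding generator_string_def xz_pauli_def by presburger
  qed (simp add: generator_string_def)
qed

section \<open>From a packing of generator products to the two measures\<close>

lemma finite_pauli_strings:
  assumes "finite V"
  shows "finite (pauli_strings V)"
proof -
  have "(UNIV :: pauli set) = {PauliI, PauliX, PauliY, PauliZ}" using pauli.exhaust by auto
  then have "finite (UNIV :: pauli set)" by (metis finite.emptyI finite.insertI)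
  from finite_set_of_finite_funs[OF assms this, of PauliI] show ?thesis
    by (rule rev_finite_subset) (auto simp: pauli_strings_def supp_def)
qed

lemma finite_stab:
  assumes "finite V"
  shows "finite (stab V \<psi>)"
proof (rule finite_subset)
  show "stab V \<psi> \<subseteq> pauli_phases \<times> pauli_strings V" by (auto simp: stab_def pauli_group_def)
  show "finite (pauli_phases \<times> pauli_strings V)"
    using finite_pauli_strings[OF assms] by (simp add: pauli_phases_def)
qed

text \<open>The \<open>2 ^ m\<close> unions of subfamilies give distinct stabilizers that are all
  restrictions of the string \<open>P\<close> of the full union, so the nullity of \<open>P\<close>
  is at least \<open>m\<close>. A single set already bounds the distance.\<close>

lemma packing_bounds:
  fixes D :: "nat \<Rightarrow> 'v set"
  assumes \<psi>: "(V, \<psi>) \<in> stabilizer_states" and \<phi>: "graph_state V E \<phi>" and eq: "locally_equivalent V \<psi> \<phi>"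
    and D: "\<And>i. i < m \<Longrightarrow> D i \<subseteq> V \<and> D i \<noteq> {} \<and> card (generator_support V E (D i)) \<le> L"
    and disj: "\<And>i j. i < m \<Longrightarrow> j < m \<Longrightarrow> i \<noteq> j \<Longrightarrow>
      generator_support V E (D i) \<inter> generator_support V E (D j) = {}"
  shows "real m \<le> alpha_loc V \<psi>" and "0 < m \<Longrightarrow> distance V \<psi> \<le> L"
proof -
  have fin: "finite V" and vanish: "\<And>A. \<not> A \<subseteq> V \<Longrightarrow> \<psi> A = 0"
    using \<psi> by (auto simp: stabilizer_states_def unit_qvec_def)
  obtain \<pi> where \<pi>: "\<And>v a. \<pi> v a = PauliI \<longleftrightarrow> a = PauliI"
    and stab: "\<And>s. s \<in> stab V \<phi> \<Longrightarrow> \<exists>\<omega>. (\<omega>, \<lambda>v. \<pi> v (snd s v)) \<in> stab V \<psi>"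
    using stab_locally_equivalent[OF fin vanish eq] by metis
  let ?S = "generator_support V E"
  define str where "str X = (\<lambda>v. \<pi> v (generator_string V E X v))" for X
  have supp_str: "supp (str X) = ?S X" for X
    unfolding supp_generator_string[symmetric] by (simp add: supp_def str_def \<pi>)
  have in_stab: "\<exists>\<omega>. (\<omega>, str X) \<in> stab V \<psi>" if X: "X \<subseteq> V" for X
  proof -
    obtain \<omega> where "(\<omega>, generator_string V E X) \<in> stab V \<phi>"
      using \<phi> generator_string_in_generate[OF _ X, of E] by (auto simp: graph_state_def)
    from stab[OF this] show ?thesis by (simp add: str_def)
  qed
  have sub: "D i \<subseteq> ?S (D i)" if "i < m" for i using D[OF that] by (auto simp: generator_support_def)
  define P where "P = str (\<Union>i<m. D i)"
  have union: "generator_string V E (\<Union>i\<in>J. D i) v = generator_string V E (D i) v"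
    if "J \<subseteq> {..<m}" "i \<in> J" "v \<in> ?S (D i)" for J i v
    using that by (intro generator_string_Union(1)[OF fin _ disj]) (use D in auto)
  have union': "generator_string V E (\<Union>i\<in>J. D i) v = PauliI"
    if "J \<subseteq> {..<m}" "v \<notin> (\<Union>i\<in>J. ?S (D i))" for J v
    using that by (intro generator_string_Union(2)[OF fin _ disj]) (use D in auto)
  have restrict: "str (\<Union>i\<in>J. D i) = pauli_restrict P (\<Union>i\<in>J. ?S (D i))" if J: "J \<subseteq> {..<m}" for J
  proof
    fix v
    show "str (\<Union>i\<in>J. D i) v = pauli_restrict P (\<Union>i\<in>J. ?S (D i)) v"
    proof (cases "v \<in> (\<Union>i\<in>J. ?S (D i))")
      case True
      then obtain i where i: "i \<in> J" "v \<in> ?S (D i)" by blast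
      then have "i \<in> {..<m}" using J by blast
      then have "generator_string V E (\<Union>i\<in>J. D i) v = generator_string V E (\<Union>i<m. D i) v"
        using union[OF J i] union[OF order_refl _ i(2)] by simp
      then show ?thesis using True by (simp add: pauli_restrict_def P_def str_def)
    next
      case False
      then have "generator_string V E (\<Union>i\<in>J. D i) v = PauliI" using union'[OF J] by blast
      then show ?thesis using False by (simp add: pauli_restrict_def str_def \<pi>)
    qed
  qed
  have supp_J: "?S (\<Union>i\<in>J. D i) = (\<Union>i\<in>J. ?S (D i))" if J: "J \<subseteq> {..<m}" for J
  proof -
    have "v \<in> supp (generator_string V E (\<Union>i\<in>J. D i))" if "i \<in> J" "v \<in> ?S (D i)" for i v
      using union[OF J that] that(2) supp_generator_string[of V E "D i"] by (auto simp: supp_def)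
    moreover have "v \<in> (\<Union>i\<in>J. ?S (D i))" if "v \<in> supp (generator_string V E (\<Union>i\<in>J. D i))" for v
      using union'[OF J, of v] that by (auto simp: supp_def)
    ultimately show ?thesis unfolding supp_generator_string by blast
  qed
  have DV: "(\<Union>i\<in>J. D i) \<subseteq> V" if "J \<subseteq> {..<m}" for J using that D by (intro UN_least) auto
  obtain \<omega> where \<omega>: "\<And>J. J \<subseteq> {..<m} \<Longrightarrow> (\<omega> J, str (\<Union>i\<in>J. D i)) \<in> stab V \<psi>"
    using in_stab[OF DV] by metis
  have supp_P: "supp P = (\<Union>i<m. ?S (D i))" unfolding P_def supp_str by (rule supp_J) simp
  show "real m \<le> alpha_loc V \<psi>"
  proof -
    let ?f = "\<lambda>J. (\<omega> J, str (\<Union>i\<in>J. D i))" and ?G = "local_subgroup (stab V \<psi>) P"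
    \<comment> \<open>A subfamily is recovered from its support, because the sets are nonempty and
      their supports disjoint.\<close>
    have inj: "inj_on ?f (Pow {..<m})"
    proof (rule inj_onI)
      fix J K assume JK: "J \<in> Pow {..<m}" "K \<in> Pow {..<m}" "?f J = ?f K"
      then have eq: "(\<Union>i\<in>J. ?S (D i)) = (\<Union>i\<in>K. ?S (D i))"
        using supp_J[of J] supp_J[of K] supp_str by (metis PowD Pair_inject)
      have "J \<subseteq> K" if JK: "J \<subseteq> {..<m}" "K \<subseteq> {..<m}" "(\<Union>i\<in>J. ?S (D i)) = (\<Union>i\<in>K. ?S (D i))" for J K
      proof
        fix i assume i: "i \<in> J"
        then have "i < m" using JK(1) by auto
        then obtain v where v: "v \<in> D i" "i < m" using D[of i] by auto
        then obtain k where k: "k \<in> K" "v \<in> ?S (D k)" using JK(3) i sub by blast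
        then have "k = i" using disj[of k i] v sub JK(2) by blast
        then show "i \<in> K" using k by simp
      qed
      then show "J = K" using JK eq by (metis PowD subset_antisym)
    qed
    have "?f ` Pow {..<m} \<subseteq> ?G"
    proof
      fix s assume "s \<in> ?f ` Pow {..<m}"
      then obtain J where J: "J \<subseteq> {..<m}" "s = ?f J" by auto
      then have "s \<in> stab V \<psi>" using \<omega> by simp
      moreover have "(\<Union>i\<in>J. ?S (D i)) \<subseteq> supp P" unfolding supp_P using J by blast
      ultimately show "s \<in> ?G" unfolding local_subgroup_def using restrict[OF J(1)] J(2) by auto
    qed
    moreover have "finite ?G" using finite_stab[OF fin] by (simp add: local_subgroup_def)
    ultimately have "card (Pow {..<m}) \<le> card ?G" using inj by (metis card_inj_on_le)
    then have "2 ^ m \<le> card ?G" by (simp add: card_Pow)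
    then have "(2::real) ^ m \<le> real (card ?G)" by (metis of_nat_le_iff of_nat_numeral of_nat_power)
    then have "log 2 (2 ^ m) \<le> log 2 (real (card ?G))" by (intro log_mono) auto
    then have "real m \<le> nullity (stab V \<psi>) P" by (simp add: nullity_def)
    also have "\<dots> \<le> alpha_loc V \<psi>"
      unfolding alpha_loc_def
    proof (rule Max_ge)
      show "finite (nullity (stab V \<psi>) ` pauli_strings V)" using finite_pauli_strings[OF fin] by simp
      show "nullity (stab V \<psi>) P \<in> nullity (stab V \<psi>) ` pauli_strings V"
        using supp_P by (intro imageI) (auto simp: pauli_strings_def generator_support_def)
    qed
    finally show ?thesis .
  qed
  show "distance V \<psi> \<le> L" if m: "0 < m"
  proof -
    obtain \<omega>' where s: "(\<omega>', str (D 0)) \<in> stab V \<psi>" using in_stab D[OF m] by blast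
    have "supp (str (D 0)) \<noteq> {}" unfolding supp_str using D[OF m] sub[OF m] by blast
    then have "(\<omega>', str (D 0)) \<noteq> \<one>\<^bsub>pauli_group V\<^esub>" by (auto simp: pauli_group_def supp_def)
    then have "distance V \<psi> \<le> weight (snd (\<omega>', str (D 0)))"
      unfolding distance_def using s finite_stab[OF fin] by (intro Min_le imageI) auto
    then show ?thesis using D[OF m] by (simp add: weight_def supp_str)
  qed
qed

section \<open>The logarithmic bounds\<close>

text \<open>With \<open>2 ^ e \<le> n < 2 ^ (e + 1)\<close>, take \<open>d = e + 1\<close>;
  \<open>ln 2 \<ge> 2 / 3\<close> bounds \<open>e\<close>, and \<open>ln n \<ge> 1\<close> absorbs
  the added one.\<close>

lemma logarithmic_exponent:
  fixes n :: nat
  assumes "3 \<le> n"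
  shows "\<exists>d. n < 2 ^ d \<and> 0 < d \<and> real d \<le> 3 * ln (real n)"
proof -
  obtain e where e: "2 ^ e \<le> n" "n < 2 ^ (e + 1)" using ex_power_ivl1[of 2 n] assms by auto
  have "(2::real) ^ e \<le> real n" using e(1) by (metis of_nat_le_iff of_nat_numeral of_nat_power)
  then have "ln ((2::real) ^ e) \<le> ln (real n)" using assms by (subst ln_le_cancel_iff) auto
  then have "real e * ln 2 \<le> ln (real n)" by (simp add: ln_realpow)
  moreover have "real e * (2 / 3) \<le> real e * ln 2" using ln2_ge_two_thirds by (intro mult_left_mono) auto
  moreover have "1 \<le> ln (real n)"
    using assms exp_le by (subst ln_ge_iff) auto
  ultimately have "real (e + 1) \<le> 3 * ln (real n)" by (simp add: field_simps)
  then show ?thesis using e(2) by (intro exI[of _ "e + 1"]) auto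
qed

text \<open>The word yields \<open>(2 ^ p + 1) * m\<close> sets with supports of size at most
  \<open>32 * d\<close>; pairing them within batches leaves \<open>m\<close> sets and doubles the
  size.\<close>

lemma perturbed_circle_graph_bounds:
  fixes V :: "nat set"
  assumes \<psi>: "(V, \<psi>) \<in> stabilizer_states" and circle: "circle_graph V H"
    and pert: "rank_perturbation p V H E" and \<phi>: "graph_state V E \<phi>" "locally_equivalent V \<psi> \<phi>"
    and n: "8 \<le> card V" "card V < 2 ^ d" and m: "2048 * d * ((2 ^ p + 1) * m) \<le> card V"
  shows "real m \<le> alpha_loc V \<psi>" and "0 < m \<Longrightarrow> distance V \<psi> \<le> 64 * d"
proof -
  have fin: "finite V" using circle by (simp add: circle_graph_def simple_graph_def)
  obtain a b where w: "double_occurrence_word V H a b" using circle_graph_word[OF circle] by blast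
  obtain D :: "nat \<Rightarrow> nat set" where D:
    "\<forall>i<(2 ^ p + 1) * m. D i \<subseteq> V \<and> D i \<noteq> {} \<and> card (generator_support V H (D i)) \<le> 32 * d"
    "\<forall>i<(2 ^ p + 1) * m. \<forall>j<(2 ^ p + 1) * m. i \<noteq> j \<longrightarrow>
      generator_support V H (D i) \<inter> generator_support V H (D j) = {}"
    using word_generator_packing[OF w fin n m] by (elim exE conjE) (rule that)
  have "\<exists>D'::nat \<Rightarrow> nat set.
    (\<forall>g<m. D' g \<subseteq> V \<and> D' g \<noteq> {} \<and> card (generator_support V E (D' g)) \<le> 2 * (32 * d)) \<and>
    (\<forall>g<m. \<forall>h<m. g \<noteq> h \<longrightarrow> generator_support V E (D' g) \<inter> generator_support V E (D' h) = {})"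
    by (rule perturbed_generator_packing[OF pert, of "2 ^ p + 1" m D]) (use D in simp_all)
  then obtain D' :: "nat \<Rightarrow> nat set" where D':
    "\<forall>g<m. D' g \<subseteq> V \<and> D' g \<noteq> {} \<and> card (generator_support V E (D' g)) \<le> 2 * (32 * d)"
    "\<forall>g<m. \<forall>h<m. g \<noteq> h \<longrightarrow> generator_support V E (D' g) \<inter> generator_support V E (D' h) = {}"
    by (elim exE conjE) (rule that)
  show "real m \<le> alpha_loc V \<psi>"
    by (rule packing_bounds(1)[OF \<psi> \<phi>, of m D' "2 * (32 * d)"]) (use D' in simp_all)
  show "distance V \<psi> \<le> 64 * d" if "0 < m"
  proof -
    have "distance V \<psi> \<le> 2 * (32 * d)"
      by (rule packing_bounds(2)[OF \<psi> \<phi>, of m D' "2 * (32 * d)"]) (use D' that in simp_all)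
    then show ?thesis by simp
  qed
qed

theorem theoremF10:
  fixes F :: "nat qstate set" and k :: nat
  assumes "weak_structure_conjecture"
    and "proper_vertex_minor_closed F"
    and "\<exists>p. structure_parameters F k p"
  shows "\<exists>c::real. \<exists>C::real. \<exists>N::nat. c > 0 \<and> C > 0 \<and> (
           \<forall>(V, \<psi>)\<in>F. N \<le> card V \<longrightarrow>
           \<not> rank_connected k V \<psi> \<or>
           (alpha_loc V \<psi> \<ge> c * (real (card V) / ln (real (card V))) \<and>
            real (distance V \<psi>) \<le> C * ln (real (card V))))"
proof -
  \<comment> \<open>\<open>p\<close> is fixed before any state, so the constants may depend on
    it.\<close>
  obtain p where p: "structure_parameters F k p" using assms(3) by blast
  have F: "F \<subseteq> stabilizer_states"
    using assms(2) by (simp add: proper_vertex_minor_closed_def state_family_def)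
  define q :: nat where "q = 2 ^ p + 1"
  \<comment> \<open>\<open>12288 = 2 * 3 * 2048\<close>: 2048 from the packing, 3 from the bound on
    \<open>d\<close>, and 2 to absorb the rounding of \<open>m\<close>.\<close>
  define c where "c = 1 / (12288 * real q)"
  have q: "0 < q" and c: "0 < c" by (simp_all add: q_def c_def add_pos_pos)
  \<comment> \<open>For large \<open>n\<close> this makes \<open>c * n / ln n\<close> exceed 1,
    which pays for the rounding and gives \<open>m > 0\<close>.\<close>
  have "eventually (\<lambda>x::real. ln x / x < c) at_top"
    using order_tendstoD(2)[OF ln_x_over_x_tendsto_0 c] .
  then have "eventually (\<lambda>n::nat. ln (real n) / real n < c) sequentially"
    using eventually_compose_filterlim filterlim_real_sequentially by blast
  then obtain N where N: "\<And>n. N \<le> n \<Longrightarrow> ln (real n) / real n < c"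
    by (auto simp: eventually_sequentially)
  have "c * (real (card V) / ln (real (card V))) \<le> alpha_loc V \<psi> \<and>
      real (distance V \<psi>) \<le> 192 * ln (real (card V))"
    if V: "(V, \<psi>) \<in> F" "max 8 N \<le> card V" "rank_connected k V \<psi>" for V \<psi>
  proof -
    define n where "n = card V"
    have n: "8 \<le> n" "ln (real n) / real n < c" using V(2) N by (auto simp: n_def)
    obtain H E \<phi> where HE: "circle_graph V H" "rank_perturbation p V H E" "graph_state V E \<phi>"
      "locally_equivalent V \<psi> \<phi>"
      using p V(1,3) unfolding structure_parameters_def by fast
    obtain d where d: "n < 2 ^ d" "0 < d" "real d \<le> 3 * ln (real n)"
      using logarithmic_exponent[of n] n by auto
    have ln_pos: "0 < ln (real n)" using n by simp
    define m where "m = n div (2048 * d * q)"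
    have "2048 * d * (q * m) \<le> n" by (simp add: m_def mult.assoc[symmetric])
    then have m_le: "2048 * d * ((2 ^ p + 1) * m) \<le> card V" by (simp add: q_def n_def)
    have "n < 2048 * d * q * (m + 1)"
      using dividend_less_times_div[of "2048 * d * q" n] d(2) q by (simp add: m_def algebra_simps)
    then have "real n < real (2048 * d * q * (m + 1))" by (simp only: of_nat_less_iff)
    also have "\<dots> = 2048 * real d * real q * (real m + 1)"
      by (simp only: of_nat_mult of_nat_add of_nat_1 of_nat_numeral)
    also have "\<dots> \<le> 2048 * (3 * ln (real n)) * real q * (real m + 1)"
      using d(3) by (intro mult_right_mono mult_left_mono) auto
    finally have "2 * c * (real n / ln (real n)) < real m + 1"
      using ln_pos q by (simp add: c_def field_simps)
    moreover have "1 < c * (real n / ln (real n))"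
      using n ln_pos by (simp add: field_simps)
    ultimately have m: "c * (real n / ln (real n)) \<le> real m" "1 < real m" by linarith+
    have \<psi>: "(V, \<psi>) \<in> stabilizer_states" using F V(1) by blast
    note bounds = perturbed_circle_graph_bounds[OF \<psi> HE _ _ m_le]
    have "real m \<le> alpha_loc V \<psi>" "distance V \<psi> \<le> 64 * d"
      using bounds n(1) d(1) m(2) by (auto simp: n_def)
    then show ?thesis using m(1) d(3) by (fold n_def) linarith
  qed
  then show ?thesis
    \<comment> \<open>\<open>192 = 64 * 3\<close> combines the support size \<open>64 * d\<close>
      with \<open>d \<le> 3 * ln n\<close>.\<close>
    using c by (intro exI[of _ c] exI[of _ 192] exI[of _ "max 8 N"]) auto
qed

end
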